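(* Let $K$ be a commutative ring, $l,n\ge1$, and let $A$ be an associative $K$-algebra generated by $l$ elements which satisfies an admissible polynomial identity of degree $n$. Let $Y$ be the (finite) set of words in the generators of length less than $n$. Then the essential height of $A$ over $Y$ is less than $$\Upsilon(n,l)=2n^{3\lceil\log_3 n\rceil+4}\,l .$$
   Context: A polynomial identity $f=0$ of total degree $n$ is admissible if at least one monomial of degree $n$ of $f$ has coefficient $1$. For a finite set $Y\subset A$, the essential height of $A$ over $Y$ is the least integer $h$ for which there exists a finite set $D\subset A$ such that $A$ is spanned as a $K$-module by products $t_1t_2\cdots t_m$ with $m\le 2h+1$, where each $t_i$ either belongs to $D$ or equals $y^k$ for some $y\in Y$, $k\ge1$, and at most $h$ of the factors $t_i$ do not belong to $D$. $\lceil x\rceil$ denotes the least integer $\ge x$. *)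

theory Defs
  imports Complex_Main
begin

fun lprod :: "'b::ring list \<Rightarrow> 'b" where
  "lprod [] = 0"
| "lprod [x] = x"
| "lprod (x # y # xs) = x * lprod (y # xs)"

definition is_algebra :: "('k::comm_ring_1 \<Rightarrow> 'b::ring \<Rightarrow> 'b) \<Rightarrow> bool" where
  "is_algebra smul \<longleftrightarrow> module smul \<and>
     (\<forall>c x y. smul c (x * y) = smul c x * y \<and> smul c (x * y) = x * smul c y)"

definition generated_by :: "('k::comm_ring_1 \<Rightarrow> 'b::ring \<Rightarrow> 'b) \<Rightarrow> (nat \<Rightarrow> 'b) \<Rightarrow> nat \<Rightarrow> bool" where
  "generated_by smul a l \<longleftrightarrow>
     module.span smul {lprod (map a w) | w. w \<noteq> [] \<and> set w \<subseteq> {..<l}} = UNIV"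

text \<open>Noncommutative polynomials without constant term in variables x_0, x_1, ...:
  finitely supported coefficient functions on words (lists of variable indices).
  Evaluation under a substitution sigma.\<close>
definition ncpoly_eval :: "('k::comm_ring_1 \<Rightarrow> 'b::ring \<Rightarrow> 'b) \<Rightarrow> (nat list \<Rightarrow> 'k) \<Rightarrow> (nat \<Rightarrow> 'b) \<Rightarrow> 'b" where
  "ncpoly_eval smul f \<sigma> = (\<Sum>w\<in>{w. f w \<noteq> 0}. smul (f w) (lprod (map \<sigma> w)))"

definition admissible_poly :: "(nat list \<Rightarrow> 'k::comm_ring_1) \<Rightarrow> nat \<Rightarrow> bool" where
  "admissible_poly f n \<longleftrightarrow> finite {w. f w \<noteq> 0} \<and> f [] = 0 \<and>
     (\<forall>w. f w \<noteq> 0 \<longrightarrow> length w \<le> n) \<and> (\<exists>w. length w = n \<and> f w = 1)"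

definition is_identity :: "('k::comm_ring_1 \<Rightarrow> 'b::ring \<Rightarrow> 'b) \<Rightarrow> (nat list \<Rightarrow> 'k) \<Rightarrow> bool" where
  "is_identity smul f \<longleftrightarrow> (\<forall>\<sigma>. ncpoly_eval smul f \<sigma> = 0)"

definition ess_height_witness :: "('k::comm_ring_1 \<Rightarrow> 'b::ring \<Rightarrow> 'b) \<Rightarrow> 'b set \<Rightarrow> nat \<Rightarrow> bool" where
  "ess_height_witness smul Y h \<longleftrightarrow> (\<exists>D. finite D \<and>
     module.span smul {lprod ts | ts. ts \<noteq> [] \<and> length ts \<le> 2 * h + 1 \<and>
        (\<forall>t\<in>set ts. t \<in> D \<or> (\<exists>y\<in>Y. \<exists>k\<ge>1. t = lprod (replicate k y))) \<and>
        length (filter (\<lambda>t. t \<notin> D) ts) \<le> h} = UNIV)"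

definition essential_height :: "('k::comm_ring_1 \<Rightarrow> 'b::ring \<Rightarrow> 'b) \<Rightarrow> 'b set \<Rightarrow> nat" where
  "essential_height smul Y = (LEAST h. ess_height_witness smul Y h)"

definition Upsilon :: "nat \<Rightarrow> nat \<Rightarrow> nat" where
  "Upsilon n l = 2 * n ^ (3 * nat \<lceil>log 3 (real n)\<rceil> + 4) * l"

end

(* A multilinear consequence of the identity rewrites every word with n consecutive,
   lexicographically decreasing blocks through smaller words, so A is spanned by the words
   without such blocks.  In a long word of this kind, n windows starting at consecutive
   positions cannot all be different: a block that recurs n times far apart would offer them in
   decreasing order.  Two equal windows at distance less than n give a long power y^k with
   |y| < n, and such a word consists of maximal periodic pieces separated by bounded words.

   Number of pieces: each long piece contains every rotation of its period, so a chain of n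
   rotations, decreasing from left to right, is impossible.  The longest chain ending at a
   rotation therefore colours the rotations with n - 1 colours such that equal colours are
   lexicographically nondecreasing from left to right.  The vector of the latest prefixes of
   length t in all colours takes at most n l values for t = 1.  As long as it is constant, each
   prefix of length 3t consists of three prefixes of length t and is determined by three
   colours, so tripling t multiplies the number of values by at most n^3.  Once t >= n, the
   vector, one colour and the period length determine the piece up to its length.  Finally, n
   pieces with the same word whose periodicity breaks in the same direction can be cut at
   suitable distances from their ends so as to form a decreasing sequence. *)

theory Submission
  imports Defs "HOL-Library.Multiset"
begin

section \<open>Linearization and rewriting\<close>

lemma lprod_append:
  "xs \<noteq> [] \<Longrightarrow> ys \<noteq> [] \<Longrightarrow> lprod (xs @ ys) = lprod xs * lprod ys"
proof (induction xs rule: lprod.induct)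
  case (2 x)
  then show ?case by (cases ys) auto
qed (auto simp: mult.assoc)

lemma lprod_Cons: "xs \<noteq> [] \<Longrightarrow> lprod (x # xs) = x * lprod xs"
  by (cases xs) auto

lemma lprod_concat:
  "ws \<noteq> [] \<Longrightarrow> \<forall>w\<in>set ws. w \<noteq> [] \<Longrightarrow> lprod (concat ws) = lprod (map lprod ws)"
proof (induction ws)
  case (Cons w ws)
  show ?case
  proof (cases "ws = []")
    case False
    then have "concat ws \<noteq> []" using Cons.prems by (cases ws) auto
    with False Cons show ?thesis by (simp add: lprod_append lprod_Cons)
  qed simp
qed simp

lemma lprod_eq_0: "0 \<in> set xs \<Longrightarrow> lprod xs = 0"
  by (induction xs rule: lprod.induct) auto

lemma sum_nth_lists_Suc:
  fixes F :: "nat list \<Rightarrow> 'b::comm_monoid_add"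
  assumes "finite J"
  shows "(\<Sum>js\<in>{js. length js = Suc k \<and> set js \<subseteq> J \<and> map g js = x # w}. F js)
    = (\<Sum>j\<in>{j\<in>J. g j = x}. \<Sum>js\<in>{js. length js = k \<and> set js \<subseteq> J \<and> map g js = w}. F (j # js))"
proof -
  let ?L = "{js. length js = k \<and> set js \<subseteq> J \<and> map g js = w}"
  have "{js. length js = Suc k \<and> set js \<subseteq> J \<and> map g js = x # w}
    = (\<lambda>(j,js). j # js) ` ({j\<in>J. g j = x} \<times> ?L)"
    by (auto simp: length_Suc_conv image_def)
  moreover have "inj_on (\<lambda>(j,js). j # js) ({j\<in>J. g j = x} \<times> ?L)"
    by (auto simp: inj_on_def)
  ultimately show ?thesis
    by (simp add: sum.reindex sum.cartesian_product split_def o_def)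
qed

text \<open>Distributivity picks one summand for each letter of \<open>w\<close>; the list of picks
  is \<open>js\<close>, and it is allowed exactly if \<open>g\<close> sends each pick to its
  letter.\<close>

lemma lprod_map_sum:
  fixes y :: "nat \<Rightarrow> 'b::ring"
  assumes "finite J" "w \<noteq> []"
  shows "lprod (map (\<lambda>x. \<Sum>j\<in>{j\<in>J. g j = x}. y j) w)
    = (\<Sum>js\<in>{js. length js = length w \<and> set js \<subseteq> J \<and> map g js = w}. lprod (map y js))"
  using assms(2)
proof (induction w)
  case (Cons x w)
  show ?case
  proof (cases "w = []")
    case True
    then show ?thesis
      by (simp add: sum_nth_lists_Suc[OF assms(1)])
         (simp add: conj_commute cong: conj_cong)
  next
    case False
    then have eq: "lprod (map y (j # js)) = y j * lprod (map y js)"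
      if "map g js = w" for j js using that False by (cases js) auto
    let ?s = "\<lambda>x. \<Sum>j\<in>{j\<in>J. g j = x}. y j"
    let ?L = "{js. length js = length w \<and> set js \<subseteq> J \<and> map g js = w}"
    have "lprod (map ?s (x # w)) = ?s x * (\<Sum>js\<in>?L. lprod (map y js))"
      using Cons.IH[OF False] False by (simp only: list.map lprod_Cons map_is_Nil_conv not_False_eq_True)
    also have "\<dots> = (\<Sum>j\<in>{j\<in>J. g j = x}. \<Sum>js\<in>?L. lprod (map y (j # js)))"
      unfolding sum_product by (intro sum.cong refl eq[symmetric]) auto
    finally show ?thesis unfolding list.size(4) add_0_right add_Suc_right sum_nth_lists_Suc[OF assms(1)] .
  qed
qed simp

text \<open>Fix a monomial \<open>w0\<close> of degree \<open>n\<close> with coefficient 1. Each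
  variable is replaced by the sum of new variables \<open>y j\<close> over the positions
  \<open>j\<close> at which it stands in \<open>w0\<close>, and by 0 if it does not occur there.
  This separates repeated variables, and the list \<open>[0..<n]\<close> inherits the coefficient of
  \<open>w0\<close>.\<close>

lemma identity_linearization:
  fixes smul :: "'k::comm_ring_1 \<Rightarrow> 'b::ring \<Rightarrow> 'b"
  assumes alg: "is_algebra smul" and adm: "admissible_poly f n" and id: "is_identity smul f"
  obtains c where "c [0..<n] = 1"
    "\<And>y. (\<Sum>js\<in>{js. length js = n \<and> set js = {..<n}}. smul (c js) (lprod (map y js))) = 0"
proof -
  interpret module smul using alg by (simp add: is_algebra_def)
  obtain w0 where w0: "length w0 = n" "f w0 = 1" using adm by (auto simp: admissible_poly_def)
  have fin: "finite {w. f w \<noteq> 0}" and f0: "f [] = 0" and flen: "\<And>w. f w \<noteq> 0 \<Longrightarrow> length w \<le> n"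
    using adm by (auto simp: admissible_poly_def)
  define g where "g = (\<lambda>j. w0 ! j)"
  define L where "L = {js. set js \<subseteq> {..<n} \<and> length js \<le> n}"
  have finL: "finite L" unfolding L_def by (rule finite_lists_length_le) simp
  define F where "F y js = smul (f (map g js)) (lprod (map y js))" for y js
  have base: "(\<Sum>js\<in>L. F y js) = 0" for y
  proof -
    let ?s = "\<lambda>x. \<Sum>j\<in>{j\<in>{..<n}. g j = x}. y j"
    let ?P = "\<lambda>w. {js. length js = length w \<and> set js \<subseteq> {..<n} \<and> map g js = w}"
    have "0 = (\<Sum>w\<in>{w. f w \<noteq> 0}. smul (f w) (lprod (map ?s w)))"
      using id by (simp add: is_identity_def ncpoly_eval_def)
    also have "\<dots> = (\<Sum>w\<in>{w. f w \<noteq> 0}. \<Sum>js\<in>?P w. F y js)"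
    proof (rule sum.cong[OF refl])
      fix w assume "w \<in> {w. f w \<noteq> 0}"
      then have "w \<noteq> []" using f0 by auto
      then show "smul (f w) (lprod (map ?s w)) = (\<Sum>js\<in>?P w. F y js)"
        by (subst lprod_map_sum) (auto simp: scale_sum_right F_def)
    qed
    \<comment> \<open>A list \<open>js\<close> determines its word \<open>map g js\<close>, so the
      index sets are disjoint.\<close>
    also have "\<dots> = (\<Sum>js\<in>(\<Union>w\<in>{w. f w \<noteq> 0}. ?P w). F y js)"
    proof (rule sum.UNION_disjoint[symmetric, OF fin])
      show "\<forall>w\<in>{w. f w \<noteq> 0}. finite (?P w)"
        by (auto intro!: finite_subset[OF _ finL] simp: L_def dest: flen)
    qed auto
    also have "\<dots> = (\<Sum>js\<in>L. F y js)"
      by (rule sum.mono_neutral_left[OF finL]) (auto simp: L_def F_def dest: flen)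
    finally show ?thesis by simp
  qed
  \<comment> \<open>Subtracting the instance with \<open>y k = 0\<close> leaves the words that contain \<open>y k\<close>. No word
    of \<open>L\<close> is longer than \<open>n\<close>, so only the multilinear ones survive for \<open>k = n\<close>.\<close>
  have step: "(\<Sum>js\<in>{js\<in>L. {..<k} \<subseteq> set js}. F y js) = 0" if "k \<le> n" for k y
    using that
  proof (induction k arbitrary: y)
    case (Suc k)
    let ?A = "{js\<in>L. {..<k} \<subseteq> set js}"
    have "0 = (\<Sum>js\<in>?A. F y js) - (\<Sum>js\<in>?A. F (y(k:=0)) js)"
      using Suc by simp
    also have "\<dots> = (\<Sum>js\<in>?A. F y js - F (y(k:=0)) js)" by (simp add: sum_subtractf)
    also have "\<dots> = (\<Sum>js\<in>?A. if k \<in> set js then F y js else 0)"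
    proof (rule sum.cong[OF refl])
      fix js
      show "F y js - F (y(k:=0)) js = (if k \<in> set js then F y js else 0)"
      proof (cases "k \<in> set js")
        case True
        then have "lprod (map (y(k:=0)) js) = 0" by (intro lprod_eq_0) force
        then show ?thesis using True by (simp add: F_def)
      next
        case False
        then have "map (y(k:=0)) js = map y js" by auto
        then show ?thesis using False by (simp add: F_def del: map_eq_conv)
      qed
    qed
    also have "\<dots> = (\<Sum>js\<in>{js\<in>?A. k \<in> set js}. F y js)"
      by (rule sum.inter_filter[symmetric]) (use finL in simp)
    also have "{js\<in>?A. k \<in> set js} = {js\<in>L. {..<Suc k} \<subseteq> set js}"
      by (auto simp: lessThan_Suc)
    finally show ?case by simp
  qed (simp add: base)
  have Ln: "{js\<in>L. {..<n} \<subseteq> set js} = {js. length js = n \<and> set js = {..<n}}"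
  proof -
    have "length js = n" if "{..<n} \<subseteq> set js" "length js \<le> n" for js
      using card_mono[OF _ that(1)] card_length[of js] that(2) by simp
    then show ?thesis unfolding L_def by auto
  qed
  show ?thesis
  proof
    have "map g [0..<n] = w0" by (rule nth_equalityI) (auto simp: w0 g_def)
    then show "(f \<circ> map g) [0..<n] = 1" using w0 by simp
    show "(\<Sum>js\<in>{js. length js = n \<and> set js = {..<n}}. smul ((f \<circ> map g) js) (lprod (map y js))) = 0" for y
      using step[of n y] unfolding Ln by (simp add: F_def)
  qed
qed

section \<open>Divisible words in the sense of Shirshov, given by windows, and their
  rewriting\<close>

definition divisible :: "nat \<Rightarrow> nat list \<Rightarrow> bool" where
  "divisible n W \<longleftrightarrow> (\<exists>x b. (\<forall>j<n. x j + b j \<le> length W) \<and>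
     (\<forall>j j'. j < j' \<and> j' < n \<longrightarrow> x j + b j \<le> x j' \<and>
        (\<exists>k. k < b j \<and> k < b j' \<and> (\<forall>i<k. W ! (x j' + i) = W ! (x j + i)) \<and>
             W ! (x j' + k) < W ! (x j + k))))"

lemma concat_slices:
  assumes "\<And>j. j < n \<Longrightarrow> z j \<le> z (Suc j)"
  shows "take (z 0) W @ concat (map (\<lambda>j. drop (z j) (take (z (Suc j)) W)) [0..<n]) = take (z n) W"
  using assms
proof (induction n)
  case (Suc n)
  then have "take (z 0) W @ concat (map (\<lambda>j. drop (z j) (take (z (Suc j)) W)) [0..<Suc n])
    = take (z n) W @ drop (z n) (take (z (Suc n)) W)" by (simp add: append_assoc[symmetric] del: append_assoc)
  also have "take (z n) W = take (z n) (take (z (Suc n)) W)" using Suc.prems[of n] by (simp add: min_absorb1)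
  finally show ?case by (simp only: append_take_drop_id)
qed simp

text \<open>The windows may have gaps between them. Each gap is attached to the block on its left;
  the first differences lie inside the windows and are not affected.\<close>

lemma divisible_factorization:
  assumes "divisible n W" "2 \<le> n"
  obtains v u v' where "W = v @ concat (map u [0..<n]) @ v'"
    "\<And>j j'. j < j' \<Longrightarrow> j' < n \<Longrightarrow>
       \<exists>c \<alpha> \<beta> r r'. u j = c @ \<beta> # r \<and> u j' = c @ \<alpha> # r' \<and> \<alpha> < (\<beta>::nat)"
    "\<And>j. j < n \<Longrightarrow> u j \<noteq> []"
proof -
  obtain x b where "\<forall>j<n. x j + b j \<le> length W"
    and *: "\<forall>j j'. j < j' \<and> j' < n \<longrightarrow> x j + b j \<le> x j' \<and>
        (\<exists>k. k < b j \<and> k < b j' \<and> (\<forall>i<k. W ! (x j' + i) = W ! (x j + i)) \<and> W ! (x j' + k) < W ! (x j + k))"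
    using assms(1) unfolding divisible_def by blast
  then have len: "\<And>j. j < n \<Longrightarrow> x j + b j \<le> length W" by blast
  have sep: "x j + b j \<le> x j'" if "j < j'" "j' < n" for j j' using * that by blast
  \<comment> \<open>The cut points: a block ends where the next window starts, and the last block
    ends with its own window.\<close>
  define z where "z j = (if j < n then x j else x (n-1) + b (n-1))" for j
  define u where "u j = drop (z j) (take (z (Suc j)) W)" for j
  have zstep: "z j + b j \<le> z (Suc j)" if "j < n" for j
  proof (cases "Suc j < n")
    case True then show ?thesis using sep[of j "Suc j"] that by (simp add: z_def)
  next
    case False
    then have "j = n - 1" using that by simp
    then show ?thesis using that by (simp add: z_def)
  qed
  have zlen: "z j \<le> length W" if "j \<le> n" for j
    using len[of j] len[of "n-1"] that assms(2) by (auto simp: z_def)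
  have ulen: "b j \<le> length (u j)" if "j < n" for j
    using zstep[OF that] zlen[of "Suc j"] that by (simp add: u_def)
  have unth: "u j ! k = W ! (x j + k)" if "j < n" "k < b j" for j k
    using that zstep[OF that(1)] zlen[of "Suc j"] by (simp add: u_def z_def)
  have less': "\<exists>c \<alpha> \<beta> r r'. u j = c @ \<beta> # r \<and> u j' = c @ \<alpha> # r' \<and> \<alpha> < \<beta>" if jj: "j < j'" "j' < n" for j j'
  proof -
    have jn: "j < n" using jj by simp
    obtain k where k: "k < b j" "k < b j'" "\<forall>i<k. W ! (x j' + i) = W ! (x j + i)" "W ! (x j' + k) < W ! (x j + k)"
      using * jj by blast
    have kl: "k < length (u j)" "k < length (u j')" using k ulen[OF jn] ulen[OF jj(2)] by auto
    have "take k (u j) = take k (u j')"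
      using kl k jn jj(2) by (intro nth_equalityI) (auto simp: unth)
    then show ?thesis using id_take_nth_drop[OF kl(1)] id_take_nth_drop[OF kl(2)] k unth[OF jn k(1)] unth[OF jj(2) k(2)]
      by metis
  qed
  show ?thesis
  proof
    have "take (z 0) W @ concat (map u [0..<n]) = take (z n) W"
      unfolding u_def by (rule concat_slices) (rule add_leD1[OF zstep])
    then show "W = take (z 0) W @ concat (map u [0..<n]) @ drop (z n) W"
      by (metis append_assoc append_take_drop_id)
    show "u j \<noteq> []" if "j < n" for j
    proof (cases "Suc j < n")
      case True then show ?thesis using less'[of j "Suc j"] by auto
    next
      case False then have "j = n - 1" "0 < j" using that assms(2) by auto
      then show ?thesis using less'[of 0 j] that by auto
    qed
  qed (fact less')
qed

text \<open>Where \<open>js\<close> first departs from \<open>[0..<n]\<close>, the indices below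
  \<open>b\<close> are used up, so an index \<open>a\<close> above \<open>b\<close> stands in its
  place and brings a smaller block. Both words use the same blocks, so their lengths agree, as
  \<open>lex\<close> demands.\<close>

lemma permuted_factors_lex_less:
  fixes u :: "nat \<Rightarrow> nat list"
  assumes less: "\<And>j j'. j < j' \<Longrightarrow> j' < n \<Longrightarrow>
       \<exists>c \<alpha> \<beta> r r'. u j = c @ \<beta> # r \<and> u j' = c @ \<alpha> # r' \<and> \<alpha> < (\<beta>::nat)"
    and js: "length js = n" "set js = {..<n}" "js \<noteq> [0..<n]"
  shows "(v @ concat (map u js) @ v', v @ concat (map u [0..<n]) @ v') \<in> lex less_than"
proof -
  obtain pre a ra b rb where d: "a \<noteq> b" "js = pre @ [a] @ ra" "[0..<n] = pre @ [b] @ rb"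
    using same_length_different[OF js(3)] js(1) by auto
  have dist: "distinct js" using js by (simp add: card_distinct)
  have pl: "length pre < n" using d(3) by (metis diff_zero length_append length_upt length_Cons add_Suc_right append_Cons le_add1 less_Suc_eq_le)
  have "b = length pre" using d(3) pl by (metis nth_append_length nth_upt add_0 append_Cons diff_zero)
  moreover have "pre = [0..<length pre]" using d(3) pl
    by (metis append_eq_conv_conj take_upt add_0 less_imp_le)
  then have "set pre = {..<length pre}" by (metis atLeast_upt)
  moreover have "a \<notin> set pre" using dist d(2) by auto
  ultimately have "b < a" using d(1) by auto
  moreover have "a < n" using js(2) d(2) by auto
  ultimately obtain c \<alpha> \<beta> r r' where u: "u b = c @ \<beta> # r" "u a = c @ \<alpha> # r'" "\<alpha> < \<beta>"
    using less by blast
  have "mset js = mset [0..<n]" using dist js(2) by (subst set_eq_iff_mset_eq_distinct[symmetric]) (auto simp: atLeast0LessThan)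
  then have "mset (map (length \<circ> u) js) = mset (map (length \<circ> u) [0..<n])" by (metis mset_map)
  then have "length (concat (map u js)) = length (concat (map u [0..<n]))"
    by (metis length_concat map_map sum_mset_sum_list)
  then show ?thesis unfolding lex_conv
    apply (simp add: d u(1,2))
    apply (rule exI[of _ "v @ concat (map u pre) @ c"])
    using u by (auto simp: u(1,2))
qed

text \<open>A linear relation is multiplied by a word. The empty word is treated apart because
  \<open>lprod []\<close> is 0, not a unit.\<close>

lemma sum_lprod_append_left:
  fixes smul :: "'k::comm_ring_1 \<Rightarrow> 'b::ring \<Rightarrow> 'b"
  assumes "is_algebra smul" "(\<Sum>j\<in>J. smul (c j) (lprod (map a (w j)))) = 0" "\<And>j. j \<in> J \<Longrightarrow> w j \<noteq> []"
  shows "(\<Sum>j\<in>J. smul (c j) (lprod (map a (v @ w j)))) = 0"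
proof (cases "v = []")
  case False
  have "(\<Sum>j\<in>J. smul (c j) (lprod (map a (v @ w j)))) = (\<Sum>j\<in>J. lprod (map a v) * smul (c j) (lprod (map a (w j))))"
    using assms(1,3) False by (intro sum.cong) (simp_all add: lprod_append is_algebra_def, metis)
  then show ?thesis using assms(2) by (simp add: sum_distrib_left[symmetric])
qed (use assms in simp)

lemma sum_lprod_append_right:
  fixes smul :: "'k::comm_ring_1 \<Rightarrow> 'b::ring \<Rightarrow> 'b"
  assumes "is_algebra smul" "(\<Sum>j\<in>J. smul (c j) (lprod (map a (w j)))) = 0" "\<And>j. j \<in> J \<Longrightarrow> w j \<noteq> []"
  shows "(\<Sum>j\<in>J. smul (c j) (lprod (map a (w j @ v)))) = 0"
proof (cases "v = []")
  case False
  have "(\<Sum>j\<in>J. smul (c j) (lprod (map a (w j @ v)))) = (\<Sum>j\<in>J. smul (c j) (lprod (map a (w j))) * lprod (map a v))"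
    using assms False by (intro sum.cong) (auto simp: lprod_append is_algebra_def)
  then show ?thesis using assms(2) by (simp add: sum_distrib_right[symmetric])
qed (use assms in simp)

text \<open>Induction along \<open>lex\<close>, which compares words of equal length only and is
  well-founded. The multilinear relation, evaluated at the blocks of a divisible word and bordered
  by \<open>v\<close> and \<open>v'\<close>, expresses this word through smaller ones; its own
  coefficient is 1, so nothing has to be divided.\<close>

lemma lprod_in_span_nondivisible:
  fixes smul :: "'k::comm_ring_1 \<Rightarrow> 'b::ring \<Rightarrow> 'b"
  assumes alg: "is_algebra smul" and n: "2 \<le> n" and c1: "c [0..<n] = 1"
    and lin: "\<And>y. (\<Sum>js\<in>{js. length js = n \<and> set js = {..<n}}. smul (c js) (lprod (map y js))) = 0"
    and W: "W \<noteq> []" "set W \<subseteq> X"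
  shows "lprod (map a W) \<in> module.span smul {lprod (map a w) | w. w \<noteq> [] \<and> set w \<subseteq> X \<and> \<not> divisible n w}"
    (is "_ \<in> module.span smul ?G")
  using W
proof (induction W rule: wf_induct_rule[OF wf_lex[OF wf_less_than]])
  case (1 W)
  interpret module smul using alg by (simp add: is_algebra_def)
  show ?case
  proof (cases "divisible n W")
    case False
    then show ?thesis using 1 by (intro span_base) auto
  next
    case True
    obtain v u v' where Weq: "W = v @ concat (map u [0..<n]) @ v'"
      and less: "\<And>j j'. j < j' \<Longrightarrow> j' < n \<Longrightarrow>
       \<exists>c \<alpha> \<beta> r r'. u j = c @ \<beta> # r \<and> u j' = c @ \<alpha> # r' \<and> \<alpha> < (\<beta>::nat)"
      and une: "\<And>j. j < n \<Longrightarrow> u j \<noteq> []"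
      using divisible_factorization[OF True n] by blast
    let ?P = "{js. length js = n \<and> set js = {..<n}}"
    let ?w = "\<lambda>js. v @ concat (map u js) @ v'"
    have finP: "finite ?P"
      by (rule finite_subset[OF _ finite_lists_length_eq[of "{..<n}" n]]) auto
    have ne: "concat (map u js) \<noteq> []" if "js \<in> ?P" for js
      using that une n by (cases js) auto
    have "lprod (map (\<lambda>j. lprod (map a (u j))) js) = lprod (map a (concat (map u js)))" if "js \<in> ?P" for js
    proof -
      have "lprod (concat (map (map a) (map u js))) = lprod (map lprod (map (map a) (map u js)))"
        using that une n by (intro lprod_concat) auto
      then show ?thesis by (simp add: map_concat o_def)
    qed
    then have "(\<Sum>js\<in>?P. smul (c js) (lprod (map a (concat (map u js))))) = 0"
      using lin[of "\<lambda>j. lprod (map a (u j))"] by simp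
    from sum_lprod_append_right[OF alg this ne]
    have "(\<Sum>js\<in>?P. smul (c js) (lprod (map a (concat (map u js) @ v')))) = 0" by blast
    from sum_lprod_append_left[OF alg this]
    have sum0: "(\<Sum>js\<in>?P. smul (c js) (lprod (map a (?w js)))) = 0" using ne by blast
    have idP: "[0..<n] \<in> ?P" by auto
    have eq: "lprod (map a W) = - (\<Sum>js\<in>?P - {[0..<n]}. smul (c js) (lprod (map a (?w js))))"
      using sum0 unfolding sum.remove[OF finP idP] c1 Weq[symmetric]
      by (simp add: add_eq_0_iff2)
    show ?thesis unfolding eq
    proof (intro span_neg span_sum span_scale)
      fix js assume js: "js \<in> ?P - {[0..<n]}"
      show "lprod (map a (?w js)) \<in> span ?G"
      proof (rule 1)
        show "(?w js, W) \<in> lex less_than"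
          unfolding Weq using js by (intro permuted_factors_lex_less[OF less]) auto
        show "?w js \<noteq> []" using ne js by auto
        show "set (?w js) \<subseteq> X" using 1(3) js unfolding Weq by (auto simp: atLeast0LessThan)
      qed
    qed
  qed
qed

section \<open>Words with few decreasing rotations\<close>

definition lexless :: "(nat \<Rightarrow> nat) \<Rightarrow> (nat \<Rightarrow> nat) \<Rightarrow> bool" where
  "lexless g h \<longleftrightarrow> (\<exists>k. (\<forall>i<k. g i = h i) \<and> g k < h k)"

lemma lexless_trans:
  assumes "lexless f g" "lexless g h"
  shows "lexless f h"
proof -
  obtain a b where "\<forall>i<a. f i = g i" "f a < g a" "\<forall>i<b. g i = h i" "g b < h b"
    using assms by (auto simp: lexless_def)
  then have "(\<forall>i<min a b. f i = h i) \<and> f (min a b) < h (min a b)"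
    by (cases a b rule: linorder_cases) auto
  then show ?thesis unfolding lexless_def by blast
qed

text \<open>The prefix of length \<open>t\<close> read in base \<open>l\<close>; for letters below \<open>l\<close> this turns the
  lexicographic order of prefixes into the order of numbers.\<close>

fun val :: "nat \<Rightarrow> nat \<Rightarrow> (nat \<Rightarrow> nat) \<Rightarrow> nat" where
  "val l 0 g = 0"
| "val l (Suc t) g = val l t g * l + g t"

lemma val_add: "val l (t + u) g = val l t g * l ^ u + val l u (\<lambda>k. g (t + k))"
  by (induction u) (simp_all add: algebra_simps)

lemma val_bound: "\<forall>k<t. g k < l \<Longrightarrow> val l t g < l ^ t"
proof (induction t)
  case (Suc t)
  then have "Suc (val l t g) \<le> l ^ t" by (simp add: Suc_leI)
  then have "Suc (val l t g) * l \<le> l ^ t * l" by (rule mult_le_mono1)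
  moreover have "g t < l" using Suc.prems by simp
  ultimately show ?case by (simp add: mult.commute)
qed simp

lemma val_eq_imp:
  "val l t h = val l t g \<Longrightarrow> \<forall>k<t. h k < l \<and> g k < l \<Longrightarrow> k < t \<Longrightarrow> h k = g k"
proof (induction t)
  case (Suc t)
  have lt: "h t < l" "g t < l" using Suc.prems by auto
  have eq: "val l t h * l + h t = val l t g * l + g t" using Suc.prems by simp
  have "h t = g t" using arg_cong[OF eq, of "\<lambda>z. z mod l"] lt by simp
  moreover have "val l t h = val l t g" using eq \<open>h t = g t\<close> lt by simp
  ultimately show ?case using Suc by (cases "k = t") auto
qed simp

lemma val_less_imp:
  "val l t h < val l t g \<Longrightarrow> \<forall>k<t. h k < l \<and> g k < l \<Longrightarrow> \<exists>k<t. (\<forall>i<k. h i = g i) \<and> h k < g k"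
proof (induction t)
  case (Suc t)
  have lt: "h t < l" "g t < l" using Suc.prems by auto
  consider "val l t h < val l t g" | "val l t h = val l t g" | "val l t g < val l t h" by linarith
  then show ?case
  proof cases
    case 1
    then show ?thesis using Suc by (meson less_SucI)
  next
    case 2
    then show ?thesis using Suc.prems val_eq_imp[OF 2] by (intro exI[of _ t]) auto
  next
    case 3
    then have "Suc (val l t g) * l \<le> val l t h * l" by (intro mult_le_mono1) simp
    then show ?thesis using Suc.prems lt by simp
  qed
qed simp

lemma card_le_fibers:
  assumes "finite A" "\<And>b. b \<in> g ` A \<Longrightarrow> card {a\<in>A. g a = b} \<le> k"
  shows "card A \<le> k * card (g ` A)"
proof -
  have "A = (\<Union>b\<in>g ` A. {a\<in>A. g a = b})" by auto
  then have "card A \<le> (\<Sum>b\<in>g ` A. card {a\<in>A. g a = b})"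
    using card_UN_le[of "g ` A" "\<lambda>b. {a\<in>A. g a = b}"] assms(1) by simp
  also have "\<dots> \<le> card (g ` A) * k" using sum_bounded_above[of "g ` A" _ k] assms(2) by simp
  finally show ?thesis by (simp add: mult.commute)
qed

lemma card_image_le_of_factor:
  assumes "finite A" "\<And>a b. a \<in> A \<Longrightarrow> b \<in> A \<Longrightarrow> \<phi> a = \<phi> b \<Longrightarrow> S a = S b"
  shows "card (S ` A) \<le> card (\<phi> ` A)"
proof (rule surj_card_le)
  show "finite (\<phi> ` A)" using assms(1) by simp
  show "S ` A \<subseteq> (\<lambda>y. S (SOME a. a \<in> A \<and> \<phi> a = y)) ` (\<phi> ` A)"
  proof
    fix x assume "x \<in> S ` A"
    then obtain a where a: "a \<in> A" "x = S a" by blast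
    then have "S a = S (SOME b. b \<in> A \<and> \<phi> b = \<phi> a)"
      using someI[of "\<lambda>b. b \<in> A \<and> \<phi> b = \<phi> a" a] assms(2) by metis
    then show "x \<in> (\<lambda>y. S (SOME a. a \<in> A \<and> \<phi> a = y)) ` (\<phi> ` A)" using a by blast
  qed
qed

text \<open>The rank of \<open>h q i\<close> among the values of \<open>h q\<close> is at most
  \<open>c\<close> and nondecreasing in \<open>i\<close>. If two indices have the same sum of ranks,
  all their ranks agree, so the sum, a number up to \<open>Q * c\<close>, determines the vector.
  Monotonicity thus makes the bounds of the coordinates add up instead of multiply.\<close>

lemma card_monotone_vectors:
  fixes h :: "nat \<Rightarrow> nat \<Rightarrow> nat"
  assumes fin: "finite I"
    and mono: "\<And>q i j. q < Q \<Longrightarrow> i \<in> I \<Longrightarrow> j \<in> I \<Longrightarrow> i \<le> j \<Longrightarrow> h q i \<le> h q j"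
    and card: "\<And>q. q < Q \<Longrightarrow> card (h q ` I) \<le> Suc c"
  shows "card ((\<lambda>i. map (\<lambda>q. h q i) [0..<Q]) ` I) \<le> Suc (Q * c)"
proof -
  define below where "below q i = {v \<in> h q ` I. v < h q i}" for q i
  define \<phi> where "\<phi> i = (\<Sum>q<Q. card (below q i))" for i
  have finb: "finite (below q i)" for q i using fin by (simp add: below_def)
  have eqle: "h q i = h q j" if "q < Q" "i \<in> I" "j \<in> I" "i \<le> j" "\<phi> i = \<phi> j" for q i j
  proof (rule ccontr)
    have le: "card (below q' i) \<le> card (below q' j)" if "q' < Q" for q'
      using mono[OF that \<open>i \<in> I\<close> \<open>j \<in> I\<close> \<open>i \<le> j\<close>] by (intro card_mono finb) (auto simp: below_def)
    have "card (below q i) = card (below q j)"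
      by (rule sum_mono_inv[of "\<lambda>q. card (below q i)" "{..<Q}"]) (use that le in \<open>auto simp: \<phi>_def\<close>)
    moreover assume "h q i \<noteq> h q j"
    then have "h q i < h q j" using mono[OF that(1-4)] by simp
    then have "below q i \<subset> below q j" using \<open>i \<in> I\<close> by (auto simp: below_def)
    then have "card (below q i) < card (below q j)" by (intro psubset_card_mono finb)
    ultimately show False by simp
  qed
  have "card ((\<lambda>i. map (\<lambda>q. h q i) [0..<Q]) ` I) \<le> card (\<phi> ` I)"
  proof (rule card_image_le_of_factor[OF fin])
    fix i j assume ij: "i \<in> I" "j \<in> I" "\<phi> i = \<phi> j"
    have "h q i = h q j" if "q < Q" for q
    proof (cases "i \<le> j")
      case True
      then show ?thesis using eqle that ij by blast
    next
      case False
      then have "h q j = h q i" using eqle[OF that ij(2,1)] ij(3) by simp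
      then show ?thesis ..
    qed
    then show "map (\<lambda>q. h q i) [0..<Q] = map (\<lambda>q. h q j) [0..<Q]" by simp
  qed
  also have "\<dots> \<le> card {..Q * c}"
  proof (rule card_mono)
    have "card (below q i) \<le> c" if "q < Q" "i \<in> I" for q i
    proof -
      have "below q i \<subset> h q ` I" using that by (auto simp: below_def)
      then have "card (below q i) < card (h q ` I)" using fin by (intro psubset_card_mono) auto
      then show ?thesis using card[OF that(1)] by simp
    qed
    then show "\<phi> ` I \<subseteq> {..Q * c}"
      using sum_bounded_above[of "{..<Q}" "\<lambda>q. card (below q i)" c for i] by (auto simp: \<phi>_def)
  qed simp
  finally show ?thesis by simp
qed

text \<open>\<open>f i\<close> stands for the infinite periodic word of the \<open>i\<close>-th
  piece from the left. In \<open>no_chain\<close> the offsets \<open>R j\<close> are free even if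
  \<open>I j = I j'\<close>, because a long piece contains its rotations in any order.\<close>

locale word_family =
  fixes m l n :: nat and f :: "nat \<Rightarrow> nat \<Rightarrow> nat" and p :: "nat \<Rightarrow> nat"
  assumes l: "1 \<le> l" and n: "2 \<le> n"
    and letters: "\<And>i k. i < m \<Longrightarrow> f i k < l"
    and period_pos: "\<And>i. i < m \<Longrightarrow> 1 \<le> p i"
    and period_less: "\<And>i. i < m \<Longrightarrow> p i < n"
    and periodic: "\<And>i k. i < m \<Longrightarrow> f i (k mod p i) = f i k"
    and no_chain: "\<not> (\<exists>I R. (\<forall>j<n. I j < m) \<and> (\<forall>j j'. j < j' \<and> j' < n \<longrightarrow> I j \<le> I j' \<and>
            lexless (\<lambda>k. f (I j') (R j' + k)) (\<lambda>k. f (I j) (R j + k))))"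
begin

abbreviation rot :: "nat \<Rightarrow> nat \<Rightarrow> nat \<Rightarrow> nat" where
  "rot i r \<equiv> (\<lambda>k. f i (r + k))"

text \<open>The first argument counts comparisons: \<open>chain k\<close> involves
  \<open>k + 1\<close> rotations.\<close>

inductive chain :: "nat \<Rightarrow> nat \<Rightarrow> nat \<Rightarrow> bool" where
  single: "i < m \<Longrightarrow> chain 0 i r"
| step: "chain k i r \<Longrightarrow> i \<le> i' \<Longrightarrow> i' < m \<Longrightarrow> lexless (rot i' r') (rot i r) \<Longrightarrow> chain (Suc k) i' r'"

text \<open>\<open>chain\<close> compares neighbours only; transitivity supplies the comparison of
  all pairs that \<open>no_chain\<close> speaks of.\<close>

lemma chain_functions:
  "chain k i r \<Longrightarrow> \<exists>I R. (\<forall>j\<le>k. I j < m) \<and> (\<forall>j j'. j < j' \<and> j' \<le> k \<longrightarrow> I j \<le> I j' \<and>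
     lexless (rot (I j') (R j')) (rot (I j) (R j))) \<and> I k = i \<and> R k = r"
proof (induction rule: chain.induct)
  case (single i r)
  then show ?case by (intro exI[of _ "\<lambda>_. i"] exI[of _ "\<lambda>_. r"]) auto
next
  case (step k i r i' r')
  then obtain I R where IR: "\<forall>j\<le>k. I j < m"
    "\<And>j j'. j < j' \<Longrightarrow> j' \<le> k \<Longrightarrow> I j \<le> I j' \<and> lexless (rot (I j') (R j')) (rot (I j) (R j))"
    "I k = i" "R k = r" by metis
  have last: "I j \<le> i' \<and> lexless (rot i' r') (rot (I j) (R j))" if "j \<le> k" for j
  proof (cases "j = k")
    case True
    then show ?thesis using IR step by auto
  next
    case False
    then have "I j \<le> i" "lexless (rot i r) (rot (I j) (R j))" using IR(2)[of j k] IR(3,4) that by auto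
    then show ?thesis using step lexless_trans by (meson order_trans)
  qed
  show ?case
    by (rule exI[of _ "I(Suc k := i')"], rule exI[of _ "R(Suc k := r')"])
       (use IR last step(3) in \<open>auto simp: le_Suc_eq\<close>)
qed

lemma chain_bound: "chain k i r \<Longrightarrow> k \<le> n - 2"
proof (rule ccontr)
  assume "chain k i r" and k: "\<not> k \<le> n - 2"
  from chain_functions[OF this(1)] obtain I R where I: "\<forall>j\<le>k. I j < m"
    and IR: "\<forall>j j'. j < j' \<and> j' \<le> k \<longrightarrow> I j \<le> I j' \<and> lexless (rot (I j') (R j')) (rot (I j) (R j))"
    by blast
  have jk: "j \<le> k" if "j < n" for j using that k by simp
  show False
    by (rule notE[OF no_chain], rule exI[of _ I], rule exI[of _ R]) (use I IR jk in simp)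
qed

text \<open>The rank function of Mirsky's theorem. \<open>GREATEST\<close> is meaningful by
  \<open>chain_bound\<close>, and the colours run from 0 to \<open>n - 2\<close>.\<close>

definition colour :: "nat \<Rightarrow> nat \<Rightarrow> nat" where
  "colour i r = (GREATEST k. chain k i r)"

lemma chain_colour: "i < m \<Longrightarrow> chain (colour i r) i r"
  unfolding colour_def using chain.single chain_bound by (rule GreatestI_nat[of "\<lambda>k. chain k i r" 0 "n - 2"]) auto

lemma colour_less: "i < m \<Longrightarrow> colour i r < n - 1"
  using chain_bound[OF chain_colour, of i r] n by simp

lemma colour_increases:
  "i \<le> i' \<Longrightarrow> i' < m \<Longrightarrow> lexless (rot i' r') (rot i r) \<Longrightarrow> colour i r < colour i' r'"
  using Greatest_le_nat[of "\<lambda>k. chain k i' r'" "Suc (colour i r)" "n - 2"]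
    chain.step[OF chain_colour, of i i' r' r] chain_bound
  by (simp add: colour_def Suc_le_eq)

text \<open>A decrease would extend the longest chain ending at the left rotation and so give the
  right one a larger colour.\<close>

lemma val_mono_colour:
  assumes "i \<le> i'" "i' < m" "colour i r = colour i' r'"
  shows "val l t (rot i r) \<le> val l t (rot i' r')"
proof (rule ccontr)
  assume "\<not> ?thesis"
  then have "val l t (rot i' r') < val l t (rot i r)" by simp
  moreover have "\<forall>k<t. rot i' r' k < l \<and> rot i r k < l" using letters assms by simp
  ultimately have "lexless (rot i' r') (rot i r)" unfolding lexless_def by (blast dest: val_less_imp)
  from colour_increases[OF assms(1,2) this] show False using assms(3) by simp
qed

section \<open>Latest prefixes in each colour and the number of states they form\<close>

definition vals :: "nat \<Rightarrow> nat \<Rightarrow> nat \<Rightarrow> nat set" where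
  "vals t i q = {Suc (val l t (rot i' r)) | i' r. i' \<le> i \<and> colour i' r = q}"

text \<open>Equal colours are nondecreasing, so the maximum is attained at the last rotation of colour
  \<open>q\<close> up to piece \<open>i\<close>; the value 0 means that there is none.\<close>

definition latest :: "nat \<Rightarrow> nat \<Rightarrow> nat \<Rightarrow> nat" where
  "latest t i q = Max (insert 0 (vals t i q))"

lemma vals_bound: "i < m \<Longrightarrow> vals t i q \<subseteq> {..l ^ t}"
  using letters by (auto simp: vals_def Suc_le_eq intro!: val_bound)

lemma finite_vals: "i < m \<Longrightarrow> finite (vals t i q)"
  by (rule finite_subset[OF vals_bound]) auto

lemma latest_bound: "i < m \<Longrightarrow> latest t i q \<le> l ^ t"
  using vals_bound[of i t q] finite_vals[of i t q] by (auto simp: latest_def)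

lemma latest_mono:
  assumes "i \<le> i'" "i' < m"
  shows "latest t i q \<le> latest t i' q"
proof -
  have "vals t i q \<subseteq> vals t i' q"
    unfolding vals_def using assms(1) by (blast intro: order_trans)
  then show ?thesis
    unfolding latest_def using finite_vals[OF assms(2)] by (intro Max_mono) auto
qed

text \<open>By \<open>val_mono_colour\<close>, no rotation of this colour in the pieces up to
  \<open>i\<close> has a larger prefix.\<close>

lemma latest_colour:
  assumes "i < m"
  shows "latest t i (colour i r) = Suc (val l t (rot i r))"
  unfolding latest_def using finite_vals[OF assms] val_mono_colour[OF _ assms]
  by (intro Max_eqI) (auto simp: vals_def assms)

lemma latest_cases:
  assumes "i < m"
  obtains "latest t i q = 0" | i' r where "i' \<le> i" "colour i' r = q" "latest t i q = Suc (val l t (rot i' r))"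
proof -
  have "latest t i q \<in> insert 0 (vals t i q)"
    unfolding latest_def using finite_vals[OF assms] by (intro Max_in) auto
  then show ?thesis using that by (auto simp: vals_def)
qed

definition state :: "nat \<Rightarrow> nat \<Rightarrow> nat list" where
  "state t i = map (latest t i) [0..<n - 1]"

lemma state_eq_iff: "state t i = state t j \<longleftrightarrow> (\<forall>q<n - 1. latest t i q = latest t j q)"
  by (auto simp: state_def)

text \<open>Each of the \<open>n - 1\<close> monotone coordinates lies in \<open>{..l}\<close>,
  which gives \<open>(n - 1) * l + 1\<close> vectors.\<close>

lemma card_state_1: "card (state 1 ` {..<m}) \<le> n * l"
proof -
  have "card ((\<lambda>i. map (\<lambda>q. latest 1 i q) [0..<n - 1]) ` {..<m}) \<le> Suc ((n - 1) * l)"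
  proof (rule card_monotone_vectors)
    fix q
    have "latest 1 i q \<le> l" if "i < m" for i using latest_bound[OF that, of 1 q] by simp
    then have "(\<lambda>i. latest 1 i q) ` {..<m} \<subseteq> {..l}" by auto
    then show "card ((\<lambda>i. latest 1 i q) ` {..<m}) \<le> Suc l"
      using card_mono[of "{..l}"] by fastforce
  qed (use latest_mono in auto)
  also have "\<dots> \<le> n * l" using l n by (cases n) auto
  finally show ?thesis by (simp add: state_def)
qed

text \<open>The thirds of the prefix are prefixes of the rotations at \<open>r\<close>,
  \<open>r + t\<close> and \<open>r + t + t\<close> of the same piece, and
  \<open>latest_colour\<close> recovers each from its colour. The first has colour \<open>q\<close>
  itself, so only two colours are free. Subtracting 1 undoes the \<open>Suc\<close> in
  \<open>vals\<close>.\<close>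

lemma latest_triple:
  assumes "i < m" "latest (3 * t) i q = Suc (val l (3 * t) (rot i r))" "colour i r = q"
  shows "\<exists>q1<n - 1. \<exists>q2<n - 1. latest (3 * t) i q = Suc ((latest t i q - 1) * l ^ (2 * t) +
           (latest t i q1 - 1) * l ^ t + (latest t i q2 - 1))"
proof -
  have "val l (3 * t) (rot i r) = val l (t + (t + t)) (rot i r)"
    by (rule arg_cong[of _ _ "\<lambda>z. val l z (rot i r)"]) simp
  also have "\<dots> = val l t (rot i r) * l ^ (2 * t) + val l t (rot i (r + t)) * l ^ t
      + val l t (rot i (r + t + t))"
    unfolding val_add by (simp add: mult_2 add.assoc)
  finally show ?thesis
    unfolding assms(2)
    by (intro exI[of _ "colour i (r + t)"] conjI exI[of _ "colour i (r + t + t)"] colour_less assms(1))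
       (simp add: latest_colour[OF assms(1)] assms(3)[symmetric])
qed

text \<open>Among the indices with a fixed state at \<open>t\<close>, each coordinate at
  \<open>3 * t\<close> has at most \<open>1 + (n - 1)^2\<close> values, so
  \<open>card_monotone_vectors\<close> leaves at most \<open>1 + (n - 1)^3\<close> states.\<close>

lemma card_state_triple: "card (state (3 * t) ` {..<m}) \<le> n ^ 3 * card (state t ` {..<m})"
proof -
  let ?U = "state (3 * t)"
  define I where "I \<sigma> = {i. i < m \<and> state t i = \<sigma>}" for \<sigma>
  have part: "?U ` {..<m} = (\<Union>\<sigma>\<in>state t ` {..<m}. ?U ` I \<sigma>)" by (auto simp: I_def)
  have bound: "card (?U ` I \<sigma>) \<le> n ^ 3" if \<sigma>: "\<sigma> \<in> state t ` {..<m}" for \<sigma>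
  proof -
    have finI: "finite (I \<sigma>)" by (simp add: I_def)
    have ne: "I \<sigma> \<noteq> {}" using \<sigma> by (auto simp: I_def)
    define i0 where "i0 = Min (I \<sigma>)"
    have i0: "i0 \<in> I \<sigma>" "\<And>i. i \<in> I \<sigma> \<Longrightarrow> i0 \<le> i" using finI ne by (auto simp: i0_def)
    have "card ((\<lambda>i. map (\<lambda>q. latest (3 * t) i q) [0..<n - 1]) ` I \<sigma>) \<le> Suc ((n - 1) * ((n - 1) * (n - 1)))"
    proof (rule card_monotone_vectors[OF finI])
      fix q assume q: "q < n - 1"
      let ?F = "\<lambda>(q1,q2). Suc ((latest t i0 q - 1) * l ^ (2 * t) +
           (latest t i0 q1 - 1) * l ^ t + (latest t i0 q2 - 1))"
      \<comment> \<open>One value is inherited from the first index \<open>i0\<close>; any other is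
        attained at a later piece and given by two colours.\<close>
      let ?V = "insert (latest (3 * t) i0 q) (?F ` ({..<n - 1} \<times> {..<n - 1}))"
      have "latest (3 * t) i q \<in> ?V" if i: "i \<in> I \<sigma>" for i
      proof -
        have im: "i < m" using i by (simp add: I_def)
        have le: "latest (3 * t) i0 q \<le> latest (3 * t) i q" by (rule latest_mono[OF i0(2)[OF i] im])
        show ?thesis
        proof (cases rule: latest_cases[OF im, of "3 * t" q])
          case 1
          then show ?thesis using le by simp
        next
          case (2 i' r)
          have i'm: "i' < m" using 2 im by simp
          have eq: "latest (3 * t) i' q = Suc (val l (3 * t) (rot i' r))"
            using latest_colour[OF i'm] 2 by blast
          show ?thesis
          proof (cases "i' \<le> i0")
            case True
            then have "latest (3 * t) i' q \<le> latest (3 * t) i0 q"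
              using i0 by (intro latest_mono) (auto simp: I_def)
            then show ?thesis using le eq 2 by simp
          next
            case False
            \<comment> \<open>Piece \<open>i'\<close> lies between \<open>i0\<close> and
              \<open>i\<close>, whose states agree, so monotonicity squeezes its state.\<close>
            have st: "latest t i' q' = latest t i0 q'" if "q' < n - 1" for q'
            proof -
              have "latest t i0 q' \<le> latest t i' q'" using False i'm by (intro latest_mono) auto
              moreover have "latest t i' q' \<le> latest t i q'" using 2 im by (intro latest_mono)
              moreover have "latest t i q' = latest t i0 q'"
                using i i0(1) that by (auto simp: I_def state_eq_iff[symmetric] dest: state_eq_iff[THEN iffD1])
              ultimately show ?thesis by simp
            qed
            obtain q1 q2 where "q1 < n - 1" "q2 < n - 1"
              "latest (3 * t) i' q = Suc ((latest t i' q - 1) * l ^ (2 * t) +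
                 (latest t i' q1 - 1) * l ^ t + (latest t i' q2 - 1))"
              using latest_triple[OF i'm eq 2(2)] by blast
            then have "latest (3 * t) i q = ?F (q1, q2)" "(q1, q2) \<in> {..<n - 1} \<times> {..<n - 1}"
              using st q eq 2 by auto
            then show ?thesis by blast
          qed
        qed
      qed
      then have "(\<lambda>i. latest (3 * t) i q) ` I \<sigma> \<subseteq> ?V" by blast
      then have "card ((\<lambda>i. latest (3 * t) i q) ` I \<sigma>) \<le> card ?V" by (intro card_mono) auto
      also have "\<dots> \<le> Suc (card (?F ` ({..<n - 1} \<times> {..<n - 1})))" by (rule card_insert_le_m1) auto
      also have "\<dots> \<le> Suc ((n - 1) * (n - 1))"
        using card_image_le[of "{..<n - 1} \<times> {..<n - 1}" ?F] by simp
      finally show "card ((\<lambda>i. latest (3 * t) i q) ` I \<sigma>) \<le> Suc ((n - 1) * (n - 1))" .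
    qed (auto simp: I_def intro: latest_mono)
    also have "\<dots> \<le> n ^ 3" using n by (cases n) (auto simp: power3_eq_cube algebra_simps)
    finally show ?thesis by (simp add: state_def)
  qed
  have "card (?U ` {..<m}) \<le> (\<Sum>\<sigma>\<in>state t ` {..<m}. card (?U ` I \<sigma>))"
    unfolding part by (rule card_UN_le) simp
  also have "\<dots> \<le> card (state t ` {..<m}) * n ^ 3"
    using sum_bounded_above[of "state t ` {..<m}" "\<lambda>\<sigma>. card (?U ` I \<sigma>)" "n ^ 3"] bound by simp
  finally show ?thesis by (simp add: mult.commute)
qed

lemma card_state_power: "card (state (3 ^ e) ` {..<m}) \<le> n ^ (3 * e + 1) * l"
proof (induction e)
  case 0
  then show ?case using card_state_1 by simp
next
  case (Suc e)
  have "card (state (3 ^ Suc e) ` {..<m}) \<le> n ^ 3 * card (state (3 ^ e) ` {..<m})"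
    using card_state_triple[of "3 ^ e"] by simp
  also have "\<dots> \<le> n ^ 3 * (n ^ (3 * e + 1) * l)" using Suc by simp
  also have "\<dots> = n ^ (3 + (3 * e + 1)) * l" by (simp only: power_add mult.assoc)
  also have "3 + (3 * e + 1) = 3 * Suc e + 1" by simp
  finally show ?case .
qed

text \<open>A prefix of length \<open>3 ^ e\<close> covers a whole period. The state yields it
  through the colour of rotation 0, and the period then determines the word. Colour and period have
  \<open>n - 1\<close> possibilities each, hence the square.\<close>

theorem card_words:
  assumes e: "n \<le> 3 ^ e"
  shows "card (f ` {..<m}) \<le> (n - 1)\<^sup>2 * n ^ (3 * e + 1) * l"
proof -
  let ?T = "3 ^ e"
  let ?\<phi> = "\<lambda>i. (state ?T i, colour i 0, p i)"
  have "card (f ` {..<m}) \<le> card (?\<phi> ` {..<m})"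
  proof (rule card_image_le_of_factor)
    fix i j assume "i \<in> {..<m}" "j \<in> {..<m}" and eq: "?\<phi> i = ?\<phi> j"
    then have im: "i < m" and jm: "j < m" by auto
    have "latest ?T i (colour i 0) = latest ?T j (colour i 0)"
      using eq colour_less[OF im, of 0] by (auto simp: state_eq_iff)
    then have "val l ?T (rot i 0) = val l ?T (rot j 0)"
      using latest_colour[OF im, of ?T 0] latest_colour[OF jm, of ?T 0] eq by simp
    then have pre: "f i k = f j k" if "k < ?T" for k
      using val_eq_imp[of l ?T "rot i 0" "rot j 0" k] letters im jm that by simp
    show "f i = f j"
    proof
      fix k
      have "k mod p i < ?T" using period_pos[OF im] period_less[OF im] e
        mod_less_divisor[of "p i" k] by linarith
      then have "f i (k mod p i) = f j (k mod p i)" by (rule pre)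
      then show "f i k = f j k" using periodic[OF im, of k] periodic[OF jm, of k] eq by simp
    qed
  qed simp
  also have "\<dots> \<le> card ((state ?T ` {..<m}) \<times> {..<n - 1} \<times> {1..<n})"
    using colour_less period_pos period_less by (intro card_mono) auto
  also have "\<dots> = card (state ?T ` {..<m}) * (n - 1)\<^sup>2" by (simp add: power2_eq_square)
  also have "\<dots> \<le> n ^ (3 * e + 1) * l * (n - 1)\<^sup>2" by (intro mult_le_mono1 card_state_power)
  finally show ?thesis by (simp add: mult.commute mult.left_commute)
qed

end

section \<open>Periodic pieces of words\<close>

lemma increasing_enumeration:
  fixes J :: "nat set"
  assumes "finite J" "n \<le> card J"
  obtains idx where "\<And>j. j < n \<Longrightarrow> idx j \<in> J" "\<And>j j'. j < j' \<Longrightarrow> j' < n \<Longrightarrow> idx j < idx j'"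
proof
  let ?xs = "sorted_list_of_set J"
  show "?xs ! j \<in> J" if "j < n" for j
    using that assms nth_mem[of j ?xs] by simp
  show "?xs ! j < ?xs ! j'" if "j < j'" "j' < n" for j j'
    using that assms sorted_wrt_nth_less[OF strict_sorted_list_of_set, of j j' J] by simp
qed

text \<open>Among \<open>n * l ^ (M + n)\<close> successive blocks of length \<open>M + n\<close>,
  some word \<open>v\<close> occurs \<open>n\<close> times. It has room for windows of length
  \<open>M\<close> at all offsets below \<open>n\<close>. Two equal windows give the repetition;
  \<open>n\<close> different ones, read in decreasing order from successive occurrences of
  \<open>v\<close>, would divide \<open>W\<close>.\<close>

lemma divisible_or_close_repetition:
  assumes l: "1 \<le> l" and n: "1 \<le> n" and W: "set W \<subseteq> {..<l}" and nd: "\<not> divisible n W"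
    and len: "r + (M + n) * (n * l ^ (M + n)) \<le> length W"
  shows "\<exists>i j. r \<le> i \<and> i < j \<and> j - i < n \<and> j + M \<le> r + (M + n) * (n * l ^ (M + n)) \<and>
    (\<forall>k<M. W ! (j + k) = W ! (i + k))"
proof (rule ccontr)
  assume none: "\<not> ?thesis"
  define B where "B = M + n"
  define Q where "Q = n * l ^ B"
  define block where "block \<beta> = take B (drop (r + \<beta> * B) W)" for \<beta>
  have fits: "r + \<beta> * B + B \<le> r + B * Q" if "\<beta> < Q" for \<beta>
    using mult_le_mono1[of "Suc \<beta>" Q B] that by (simp add: mult.commute)
  have len': "r + B * Q \<le> length W" using len by (simp add: B_def Q_def)
  have block: "length (block \<beta>) = B" "set (block \<beta>) \<subseteq> {..<l}" if "\<beta> < Q" for \<beta>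
    using fits[OF that] len' W set_take_subset[of B "drop (r + \<beta> * B) W"] set_drop_subset[of "r + \<beta> * B" W]
    by (auto simp: block_def)
  have "\<exists>v\<in>block ` {..<Q}. n \<le> card {\<beta>\<in>{..<Q}. block \<beta> = v}"
  proof (rule ccontr)
    assume "\<not> ?thesis"
    then have "Q \<le> (n - 1) * card (block ` {..<Q})"
      using card_le_fibers[of "{..<Q}" block "n - 1"] by force
    also have "\<dots> \<le> (n - 1) * card {xs. set xs \<subseteq> {..<l} \<and> length xs = B}"
      using block by (intro mult_le_mono2 card_mono finite_lists_length_eq) auto
    also have "\<dots> = (n - 1) * l ^ B" by (simp add: card_lists_length_eq)
    also have "\<dots> < n * l ^ B" using l n by (intro mult_strict_right_mono) auto
    finally show False by (simp add: Q_def)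
  qed
  then obtain v where v: "v \<in> block ` {..<Q}" "n \<le> card {\<beta>\<in>{..<Q}. block \<beta> = v}" by blast
  obtain idx where idx: "\<And>j. j < n \<Longrightarrow> idx j \<in> {\<beta>\<in>{..<Q}. block \<beta> = v}"
    "\<And>j j'. j < j' \<Longrightarrow> j' < n \<Longrightarrow> idx j < idx j'"
    using increasing_enumeration[OF _ v(2)] by auto
  have idxQ: "idx j < Q" "block (idx j) = v" if "j < n" for j using idx(1)[OF that] by auto
  have vlen: "length v = B" and vset: "set v \<subseteq> {..<l}" using v(1) block by auto
  have nth: "W ! (r + idx j * B + k) = v ! k" if "j < n" "k < B" for j k
    using idxQ[OF that(1)] that(2) fits[of "idx j"] len' by (auto simp: block_def)
  define V where "V a = val l M (\<lambda>k. v ! (a + k))" for a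
  have letter: "v ! (a + k) < l" if "a < n" "k < M" for a k
  proof -
    have "v ! (a + k) \<in> set v" using that vlen by (intro nth_mem) (simp add: B_def)
    then show ?thesis using vset by auto
  qed
  have ne: "V a \<noteq> V b" if ab: "a < b" "b < n" for a b
  proof
    assume "V a = V b"
    then have eq: "v ! (a + k) = v ! (b + k)" if "k < M" for k
      using val_eq_imp[of l M "\<lambda>k. v ! (a + k)" "\<lambda>k. v ! (b + k)" k] letter ab that by (simp add: V_def)
    let ?o = "r + idx 0 * B"
    have n0: "0 < n" using n by simp
    have "W ! (?o + b + k) = W ! (?o + a + k)" if "k < M" for k
      using nth[OF n0, of "a + k"] nth[OF n0, of "b + k"] eq[OF that] ab that by (simp add: B_def add.assoc)
    moreover have "?o + b + M \<le> r + B * Q" using fits[OF idxQ(1)[OF n0]] ab by (simp add: B_def)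
    ultimately have "\<exists>i j. r \<le> i \<and> i < j \<and> j - i < n \<and> j + M \<le> r + B * Q \<and> (\<forall>k<M. W ! (j + k) = W ! (i + k))"
      using ab by (intro exI[of _ "?o + a"] exI[of _ "?o + b"]) auto
    then show False using none by (simp add: B_def Q_def)
  qed
  then have "inj_on V {..<n}" by (auto simp: inj_on_def) (metis linorder_neqE_nat)
  then have "card (V ` {..<n}) = n" by (simp add: card_image)
  then obtain c where c: "\<And>j. j < n \<Longrightarrow> c j \<in> V ` {..<n}" "\<And>j j'. j < j' \<Longrightarrow> j' < n \<Longrightarrow> c j < c j'"
    using increasing_enumeration[of "V ` {..<n}" n] by auto
  \<comment> \<open>The values \<open>c\<close> increase, so the index is reversed to give the
    leftmost occurrence the largest window.\<close>
  have "\<exists>a<n. V a = c (n - 1 - j)" if "j < n" for j using c(1)[of "n - 1 - j"] that by auto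
  then obtain \<tau> where \<tau>: "\<And>j. j < n \<Longrightarrow> \<tau> j < n \<and> V (\<tau> j) = c (n - 1 - j)" by metis
  have "divisible n W"
    unfolding divisible_def
  proof (rule exI[of _ "\<lambda>j. r + idx j * B + \<tau> j"], rule exI[of _ "\<lambda>_. M"], intro conjI allI impI)
    fix j assume j: "j < n"
    then show "r + idx j * B + \<tau> j + M \<le> length W" using fits[OF idxQ(1)[OF j]] \<tau>[OF j] len' by (simp add: B_def)
  next
    fix j j' assume jj: "j < j' \<and> j' < n"
    then have jn: "j < n" "j' < n" by auto
    have "Suc (idx j) * B \<le> idx j' * B" using idx(2)[of j j'] jj by (intro mult_le_mono1) simp
    then show "r + idx j * B + \<tau> j + M \<le> r + idx j' * B + \<tau> j'" using \<tau>[OF jn(1)] by (simp add: B_def)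
    have "n - 1 - j' < n - 1 - j" using jj by auto
    then have "V (\<tau> j') < V (\<tau> j)" using \<tau> jn c(2)[of "n - 1 - j'" "n - 1 - j"] n by simp
    then obtain k where k: "k < M" "\<forall>i<k. v ! (\<tau> j' + i) = v ! (\<tau> j + i)" "v ! (\<tau> j' + k) < v ! (\<tau> j + k)"
      using val_less_imp[of l M "\<lambda>k. v ! (\<tau> j' + k)" "\<lambda>k. v ! (\<tau> j + k)"] letter \<tau> jn by (auto simp: V_def)
    have w: "W ! (r + idx i * B + \<tau> i + k') = v ! (\<tau> i + k')" if "i < n" "k' < M" for i k'
      using nth[OF that(1), of "\<tau> i + k'"] \<tau>[OF that(1)] that by (simp add: B_def add.assoc)
    show "\<exists>k<M. k < M \<and> (\<forall>i<k. W ! (r + idx j' * B + \<tau> j' + i) = W ! (r + idx j * B + \<tau> j + i)) \<and>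
       W ! (r + idx j' * B + \<tau> j' + k) < W ! (r + idx j * B + \<tau> j + k)"
      using k w jn by (intro exI[of _ k]) auto
  qed
  then show False using nd by contradiction
qed

text \<open>\<open>e\<close> is exclusive. Maximality is asked at the right end only, where the
  break of the period will order pieces with the same word.\<close>

definition piece :: "nat list \<Rightarrow> nat \<Rightarrow> nat \<Rightarrow> nat \<Rightarrow> nat \<Rightarrow> nat \<Rightarrow> bool" where
  "piece W n M s e p \<longleftrightarrow> 1 \<le> p \<and> p < n \<and> s + M \<le> e \<and> e \<le> length W \<and>
     (\<forall>k. s \<le> k \<and> k + p < e \<longrightarrow> W ! (k + p) = W ! k) \<and> (e < length W \<longrightarrow> W ! e \<noteq> W ! (e - p))"

lemma piece_exists:
  assumes "1 \<le> l" "1 \<le> n" "set W \<subseteq> {..<l}" "\<not> divisible n W"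
    and N: "N = (M + n) * (n * l ^ (M + n))" "r + N \<le> length W" and nM: "n \<le> M"
  shows "\<exists>s e p. r \<le> s \<and> s \<le> r + N \<and> piece W n M s e p"
proof -
  obtain i j where ij: "r \<le> i" "i < j" "j - i < n" "j + M \<le> r + N" "\<forall>k<M. W ! (j + k) = W ! (i + k)"
    using divisible_or_close_repetition[OF assms(1-4), of r M] N by auto
  define P where "P e \<longleftrightarrow> i + M \<le> e \<and> e \<le> length W \<and> (\<forall>k. i \<le> k \<and> k + (j - i) < e \<longrightarrow> W ! (k + (j - i)) = W ! k)" for e
  have "P (j + M)"
    unfolding P_def
  proof (intro conjI allI impI)
    fix k assume k: "i \<le> k \<and> k + (j - i) < j + M"
    then have "k + (j - i) = j + (k - i)" "k - i < M" "i + (k - i) = k" using ij by auto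
    then show "W ! (k + (j - i)) = W ! k" using ij(5) by metis
  qed (use ij N in auto)
  moreover have Pb: "\<forall>e. P e \<longrightarrow> e \<le> length W" by (simp add: P_def)
  ultimately have Pe: "P (Greatest P)" by (intro GreatestI_nat[of P "j + M" "length W"]) auto
  define e where "e = Greatest P"
  have "W ! e \<noteq> W ! (e - (j - i))" if "e < length W"
  proof
    assume eq: "W ! e = W ! (e - (j - i))"
    have "P (Suc e)"
      unfolding P_def
    proof (intro conjI allI impI)
      fix k assume k: "i \<le> k \<and> k + (j - i) < Suc e"
      show "W ! (k + (j - i)) = W ! k"
      proof (cases "k + (j - i) = e")
        case True
        then have "e - (j - i) = k" by simp
        then show ?thesis using eq True by simp
      qed (use Pe k in \<open>auto simp: P_def e_def\<close>)
    qed (use Pe that in \<open>auto simp: P_def e_def\<close>)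
    then have "Suc e \<le> e" unfolding e_def using Pb by (intro Greatest_le_nat[of P _ "length W"]) auto
    then show False by simp
  qed
  then have "piece W n M i e (j - i)"
    using Pe ij by (auto simp: piece_def P_def e_def)
  then show ?thesis using ij by (intro exI[of _ i] exI) auto
qed

text \<open>Going back by whole periods stays inside the piece until its first period is
  reached.\<close>

lemma piece_periodic:
  assumes "piece W n M s e p" "s + k < e"
  shows "W ! (s + k) = W ! (s + k mod p)"
  using assms(2)
proof (induction k rule: less_induct)
  case (less k)
  show ?case
  proof (cases "k < p")
    case False
    have "1 \<le> p" and per: "\<And>k. s \<le> k \<Longrightarrow> k + p < e \<Longrightarrow> W ! (k + p) = W ! k"
      using assms(1) by (auto simp: piece_def)
    then have "W ! (s + k) = W ! (s + (k - p))" using per[of "s + (k - p)"] False less.prems by simp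
    also have "\<dots> = W ! (s + (k - p) mod p)" using less False \<open>1 \<le> p\<close> by (intro less.IH) auto
    also have "(k - p) mod p = k mod p" using False by (simp add: le_mod_geq)
    finally show ?thesis .
  qed simp
qed

text \<open>The record of a scan from left to right that has reached \<open>r\<close>; at most
  \<open>N\<close> letters are skipped before each piece and after the last.\<close>

fun pieces_from :: "nat list \<Rightarrow> nat \<Rightarrow> nat \<Rightarrow> nat \<Rightarrow> nat \<Rightarrow> (nat \<times> nat \<times> nat) list \<Rightarrow> bool" where
  "pieces_from W n M N r [] \<longleftrightarrow> r \<le> length W \<and> length W \<le> r + N"
| "pieces_from W n M N r ((s, e, p) # ps) \<longleftrightarrow>
     r \<le> s \<and> s \<le> r + N \<and> piece W n M s e p \<and> pieces_from W n M N e ps"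

lemma pieces_exist:
  assumes "1 \<le> l" "1 \<le> n" "set W \<subseteq> {..<l}" "\<not> divisible n W"
    and "N = (M + n) * (n * l ^ (M + n))" "n \<le> M" "r \<le> length W"
  shows "\<exists>ps. pieces_from W n M N r ps"
  using assms(7)
proof (induction "length W - r" arbitrary: r rule: less_induct)
  case less
  show ?case
  proof (cases "r + N \<le> length W")
    case True
    obtain s e p where sep: "r \<le> s" "s \<le> r + N" "piece W n M s e p"
      using piece_exists[OF assms(1-5) True assms(6)] by blast
    then have "s + M \<le> e" "e \<le> length W" by (auto simp: piece_def)
    moreover from this have "length W - e < length W - r" using assms(2,6) sep(1) by linarith
    ultimately obtain ps where "pieces_from W n M N e ps" using less.hyps[of e] by blast
    then show ?thesis using sep by (intro exI[of _ "(s, e, p) # ps"]) simp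
  qed (use less.prems in \<open>intro exI[of _ "[]"], simp\<close>)
qed

lemma piece_take:
  assumes "piece W n M s e p" "s + q * p \<le> e"
  shows "take (q * p) (drop s W) = concat (replicate q (take p (drop s W)))"
  using assms(2)
proof (induction q)
  case (Suc q)
  have len: "e \<le> length W" using assms(1) by (simp add: piece_def)
  have "take p (drop (s + q * p) W) = take p (drop s W)"
  proof (rule nth_equalityI)
    fix i assume "i < length (take p (drop (s + q * p) W))"
    then have i: "i < p" by simp
    then have "W ! (s + (q * p + i)) = W ! (s + (q * p + i) mod p)"
      using Suc.prems by (intro piece_periodic[OF assms(1)]) simp
    then show "take p (drop (s + q * p) W) ! i = take p (drop s W) ! i"
      using i Suc.prems len by (simp add: add.assoc)
  qed (use Suc.prems len in simp)
  then have "take (q * p + p) (drop s W) = concat (replicate q (take p (drop s W))) @ take p (drop s W)"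
    using Suc by (simp add: take_add add.commute[of s])
  also have "\<dots> = concat (replicate (Suc q) (take p (drop s W)))"
    using arg_cong[OF replicate_append_same[of q "take p (drop s W)"], of concat] by simp
  finally show ?case by (simp add: add.commute)
qed simp

text \<open>A piece is a power of its first period followed by fewer than \<open>n\<close> letters,
  which are left to the next gap. Therefore the remaining suffix starts at \<open>r0\<close>, up to
  \<open>n\<close> before \<open>r\<close>, and gaps are bounded by \<open>N + n\<close>. Each piece
  contributes at most one gap and one power.\<close>

lemma pieces_factorization:
  assumes "pieces_from W n M N r ps" "r0 \<le> r" "r \<le> r0 + n" "n \<le> M"
  shows "\<exists>ws. drop r0 W = concat ws \<and> length ws \<le> 2 * length ps + 1 \<and> [] \<notin> set ws \<and>
    (\<forall>w\<in>set ws. length w \<le> N + n \<or>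
       (\<exists>y k. y \<noteq> [] \<and> length y < n \<and> set y \<subseteq> set W \<and> 1 \<le> k \<and> w = concat (replicate k y))) \<and>
    length (filter (\<lambda>w. N + n < length w) ws) \<le> length ps"
  using assms
proof (induction W n M N r ps arbitrary: r0 rule: pieces_from.induct)
  case (1 W n M N r)
  then show ?case
    by (cases "drop r0 W = []") (fastforce intro: exI[of _ "[]"], fastforce intro: exI[of _ "[drop r0 W]"])
next
  case (2 W n M N r s e p ps)
  have pc: "piece W n M s e p" and rs: "r \<le> s" "s \<le> r + N" using 2 by auto
  then have p: "1 \<le> p" "p < n" "s + M \<le> e" "e \<le> length W" by (auto simp: piece_def)
  define q where "q = (e - s) div p"
  have qe: "s + q * p \<le> e" using p by (simp add: q_def)
     (metis le_add_diff_inverse add_le_cancel_left add_leD1 div_times_less_eq_dividend)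
  have "(e - s) mod p < p" using p by simp
  then have eq: "e \<le> s + q * p + n"
    using p div_mult_mod_eq[of "e - s" p] unfolding q_def by linarith
  have q1: "1 \<le> q" using p \<open>n \<le> M\<close> unfolding q_def by (simp add: Suc_le_eq div_greater_zero_iff)
  obtain ws where ws: "drop (s + q * p) W = concat ws" "length ws \<le> 2 * length ps + 1" "[] \<notin> set ws"
    "\<forall>w\<in>set ws. length w \<le> N + n \<or>
       (\<exists>y k. y \<noteq> [] \<and> length y < n \<and> set y \<subseteq> set W \<and> 1 \<le> k \<and> w = concat (replicate k y))"
    "length (filter (\<lambda>w. N + n < length w) ws) \<le> length ps"
    using 2(1)[OF _ qe eq] 2(2,5) by auto
  define d where "d = take (s - r0) (drop r0 W)"
  define y where "y = take p (drop s W)"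
  define w where "w = concat (replicate q y)"
  have y: "y \<noteq> []" "length y < n" "set y \<subseteq> set W"
    using p \<open>n \<le> M\<close> set_take_subset[of p "drop s W"] set_drop_subset[of s W] by (auto simp: y_def)
  have dlen: "length d \<le> N + n" using rs 2(4) by (simp add: d_def)
  have "drop r0 W = d @ drop s W" using rs 2(3)
    by (simp add: d_def) (metis append_take_drop_id drop_drop le_add_diff_inverse2 order_trans)
  also have "drop s W = w @ drop (s + q * p) W"
    using piece_take[OF pc qe] append_take_drop_id[of "q * p" "drop s W"] by (simp add: w_def y_def add.commute)
  finally have dr: "drop r0 W = d @ w @ concat ws" using ws(1) by simp
  have wne: "w \<noteq> []" using y q1 by (cases q) (auto simp: w_def)
  have wpow: "\<exists>y k. y \<noteq> [] \<and> length y < n \<and> set y \<subseteq> set W \<and> 1 \<le> k \<and> w = concat (replicate k y)"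
    using y q1 w_def by blast
  show ?case
    \<comment> \<open>An empty gap is left out, since as a factor it would contribute
      \<open>lprod [] = 0\<close>.\<close>
    by (rule exI[of _ "(if d = [] then [] else [d]) @ [w] @ ws"]) (use dr ws dlen wne wpow in auto)
qed

lemma pieces_from_start: "pieces_from W n M N r ps \<Longrightarrow> i < length ps \<Longrightarrow> r \<le> fst (ps ! i)"
proof (induction W n M N r ps arbitrary: i rule: pieces_from.induct)
  case (2 W n M N r s e p ps)
  then show ?case by (cases i) (fastforce simp: piece_def)+
qed simp

lemma pieces_from_piece:
  "pieces_from W n M N r ps \<Longrightarrow> i < length ps \<Longrightarrow>
    piece W n M (fst (ps ! i)) (fst (snd (ps ! i))) (snd (snd (ps ! i)))"
proof (induction W n M N r ps arbitrary: i rule: pieces_from.induct)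
  case (2 W n M N r s e p ps)
  then show ?case by (cases i) auto
qed simp

lemma pieces_from_ordered:
  "pieces_from W n M N r ps \<Longrightarrow> i < j \<Longrightarrow> j < length ps \<Longrightarrow> fst (snd (ps ! i)) \<le> fst (ps ! j)"
proof (induction W n M N r ps arbitrary: i j rule: pieces_from.induct)
  case (2 W n M N r s e p ps)
  then show ?case using pieces_from_start[of W n M N e ps "j - 1"]
    by (cases i; cases j) auto
qed simp

section \<open>Counting the pieces\<close>

text \<open>\<open>M\<close> has room for \<open>n + 2\<close> shifts by
  \<open>(n * n + n) * fact n\<close>. The factorial makes a shift a multiple of every period; the
  other factor lets it exceed an offset below \<open>n\<close> followed by a window of length
  \<open>n * n\<close>.\<close>

locale long_pieces =
  fixes W :: "nat list" and l n m M :: nat and s e p :: "nat \<Rightarrow> nat"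
  assumes l: "1 \<le> l" and n: "2 \<le> n" and W: "set W \<subseteq> {..<l}" and nd: "\<not> divisible n W"
    and M: "M = (n + 2) * ((n * n + n) * fact n)"
    and pc: "\<And>i. i < m \<Longrightarrow> piece W n M (s i) (e i) (p i)"
    and ordered: "\<And>i j. i < j \<Longrightarrow> j < m \<Longrightarrow> e i \<le> s j"
begin

text \<open>A common multiple of all periods: moving by \<open>step\<close> inside a piece preserves the phase.\<close>

definition step :: nat where "step = (n * n + n) * fact n"

text \<open>The infinite periodic continuation, which makes pieces of different lengths
  comparable.\<close>

definition word :: "nat \<Rightarrow> nat \<Rightarrow> nat" where "word i k = W ! (s i + k mod p i)"

lemma M_step: "M = (n + 2) * step" by (simp add: M step_def)

lemma step_ge: "n * n + n \<le> step"
  using mult_le_mono2[of 1 "fact n" "n * n + n"] by (simp add: step_def)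

lemma step_mult_le: "c \<le> n + 2 \<Longrightarrow> c * step \<le> M"
  unfolding M_step by (rule mult_le_mono1)

lemma p_facts:
  assumes "i < m"
  shows "1 \<le> p i" "p i < n" "s i + M \<le> e i" "e i \<le> length W" "p i dvd step"
proof -
  show "1 \<le> p i" "p i < n" "s i + M \<le> e i" "e i \<le> length W" using pc[OF assms] by (auto simp: piece_def)
  then show "p i dvd step" unfolding step_def by (intro dvd_mult dvd_fact) auto
qed

lemma word_mod: "word i (k mod p i) = word i k"
  by (simp add: word_def)

lemma word_nth: "i < m \<Longrightarrow> s i + k < e i \<Longrightarrow> W ! (s i + k) = word i k"
  unfolding word_def by (rule piece_periodic[OF pc])

lemma word_less:
  assumes "i < m"
  shows "word i k < l"
proof -
  have "k mod p i < M" using p_facts[OF assms] mod_less_divisor[of "p i" k] step_ge step_mult_le[of 1] by linarith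
  then have "W ! (s i + k mod p i) \<in> set W" using p_facts[OF assms] by (intro nth_mem) linarith
  then show ?thesis using W by (auto simp: word_def)
qed

text \<open>Both sequences have period \<open>p i * p j\<close>, which is at most
  \<open>n * n\<close>, so a later difference would already occur at its residue.\<close>

lemma words_differ_early:
  assumes im: "i < m" "j < m" and less: "lexless (\<lambda>k. word j (r' + k)) (\<lambda>k. word i (r + k))"
  obtains k where "k < n * n" "\<forall>k'<k. word j (r' + k') = word i (r + k')" "word j (r' + k) < word i (r + k)"
proof -
  obtain k where k: "\<forall>k'<k. word j (r' + k') = word i (r + k')" "word j (r' + k) < word i (r + k)"
    using less by (auto simp: lexless_def)
  have "k < n * n"
  proof (rule ccontr)
    assume big: "\<not> k < n * n"
    let ?P = "p i * p j"
    have "?P \<le> n * n" "0 < ?P" using p_facts[OF im(1)] p_facts[OF im(2)] by (auto intro: mult_le_mono)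
    then have "k mod ?P < k" using big mod_less_divisor[of ?P k] by linarith
    then have "word j (r' + k mod ?P) = word i (r + k mod ?P)" using k by blast
    moreover have "word i (r + k mod ?P) = word i (r + k)"
      unfolding word_def by (metis mod_mult_right_eq mod_add_right_eq mod_mod_cancel dvd_triv_left)
    moreover have "word j (r' + k mod ?P) = word j (r' + k)"
      unfolding word_def by (metis mod_mult_right_eq mod_add_right_eq mod_mod_cancel dvd_triv_right)
    ultimately show False using k(2) by simp
  qed
  then show ?thesis using that k by blast
qed

text \<open>The rotations are realized as disjoint windows of \<open>W\<close> of length
  \<open>n * n\<close>, long enough to show the differences.\<close>

lemma no_chain:
  assumes I: "\<And>j. j < n \<Longrightarrow> I j < m"
    and IR: "\<And>j j'. j < j' \<Longrightarrow> j' < n \<Longrightarrow> I j \<le> I j' \<and>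
            lexless (\<lambda>k. word (I j') (R j' + k)) (\<lambda>k. word (I j) (R j + k))"
  shows False
proof -
  \<comment> \<open>Adding \<open>j * step\<close> keeps the phase \<open>R j\<close> and moves
    later windows to the right even within one piece.\<close>
  define d where "d j = R j mod p (I j) + j * step" for j
  define x where "x j = s (I j) + d j" for j
  have d: "d j + n * n \<le> Suc j * step" "Suc j * step \<le> M" if "j < n" for j
  proof -
    have "R j mod p (I j) < n" using p_facts[OF I[OF that]] mod_less_divisor[of "p (I j)" "R j"] by linarith
    then show "d j + n * n \<le> Suc j * step" using step_ge by (simp add: d_def)
    show "Suc j * step \<le> M" using that by (intro step_mult_le) simp
  qed
  have nth: "W ! (x j + k) = word (I j) (R j + k)" if jn: "j < n" and kn: "k < n * n" for j k
  proof -
    have "d j + k < M" using d[OF jn] kn by linarith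
    then have "W ! (x j + k) = word (I j) (d j + k)"
      using word_nth[OF I[OF jn], of "d j + k"] p_facts(3)[OF I[OF jn]] by (simp add: x_def add.assoc)
    also have "(d j + k) mod p (I j) = (R j + k) mod p (I j)"
    proof -
      obtain c where c: "step = p (I j) * c" using p_facts(5)[OF I[OF jn]] by (elim dvdE)
      have "(d j + k) mod p (I j) = (R j mod p (I j) + k + p (I j) * (j * c)) mod p (I j)"
        by (simp add: d_def c ac_simps)
      then show ?thesis by (simp only: mod_mult_self2 mod_add_left_eq)
    qed
    then have "word (I j) (d j + k) = word (I j) (R j + k)" by (simp add: word_def)
    finally show ?thesis .
  qed
  have "divisible n W"
    unfolding divisible_def
  proof (rule exI[of _ x], rule exI[of _ "\<lambda>_. n * n"], intro conjI allI impI)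
    fix j assume "j < n"
    then show "x j + n * n \<le> length W" using d[of j] p_facts[OF I, of j] by (simp add: x_def)
  next
    fix j j' assume jj: "j < j' \<and> j' < n"
    then have jn: "j < n" by simp
    have "I j \<le> I j'" using IR jj by blast
    show "x j + n * n \<le> x j'"
    proof (cases "I j = I j'")
      case True
      have "Suc j * step \<le> j' * step" using jj by (intro mult_le_mono1) simp
      then show ?thesis using d[OF jn] unfolding x_def d_def[of j'] True by linarith
    next
      case False
      then have "e (I j) \<le> s (I j')" using ordered I jj \<open>I j \<le> I j'\<close> by simp
      then show ?thesis using d[OF jn] p_facts(3)[OF I[OF jn]] unfolding x_def by linarith
    qed
    obtain k where "k < n * n" "\<forall>k'<k. word (I j') (R j' + k') = word (I j) (R j + k')"
      "word (I j') (R j' + k) < word (I j) (R j + k)"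
      using words_differ_early[of "I j" "I j'" "R j'" "R j"] I IR jj jn by blast
    then show "\<exists>k<n * n. k < n * n \<and> (\<forall>i<k. W ! (x j' + i) = W ! (x j + i)) \<and> W ! (x j' + k) < W ! (x j + k)"
      using nth jj jn by (intro exI[of _ k]) auto
  qed
  then show False using nd by contradiction
qed

lemma card_words_le:
  assumes "n \<le> 3 ^ c"
  shows "card (word ` {..<m}) \<le> (n - 1)\<^sup>2 * n ^ (3 * c + 1) * l"
proof -
  have "\<not> (\<exists>I R. (\<forall>j<n. I j < m) \<and> (\<forall>j j'. j < j' \<and> j' < n \<longrightarrow> I j \<le> I j' \<and>
            lexless (\<lambda>k. word (I j') (R j' + k)) (\<lambda>k. word (I j) (R j + k))))"
  proof clarify
    fix I R :: "nat \<Rightarrow> nat"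
    assume "\<forall>j<n. I j < m" "\<forall>j j'. j < j' \<and> j' < n \<longrightarrow> I j \<le> I j' \<and>
      lexless (\<lambda>k. word (I j') (R j' + k)) (\<lambda>k. word (I j) (R j + k))"
    then show False by (intro no_chain[of I R]) simp_all
  qed
  then interpret word_family m l n word p
    by unfold_locales (use l n word_less p_facts word_mod in simp_all)
  show ?thesis by (rule card_words[OF assms])
qed

text \<open>A window of \<open>W\<close> that starts at a full period and runs to the end of the piece, where the
  periodicity breaks.\<close>
lemma end_window:
  assumes i: "i < m" and c: "1 \<le> c" "c \<le> n"
  defines "L \<equiv> (e i - s i) mod p i + c * step"
  shows "L < Suc c * step" "s i + L < e i" "\<And>k. k < L \<Longrightarrow> W ! (e i - L + k) = word i k"
    "word i L = word i (e i - s i)"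
proof -
  note pf = p_facts[OF i]
  have "(e i - s i) mod p i < n" using pf mod_less_divisor[of "p i" "e i - s i"] by linarith
  then show L1: "L < Suc c * step" using step_ge by (simp add: L_def)
  also have "Suc c * step \<le> M" using c by (intro step_mult_le) simp
  finally show L2: "s i + L < e i" using pf by simp
  have pL: "p i dvd c * step" using pf(5) by simp
  have "e i - s i - L = (e i - s i) div p i * p i - c * step"
    unfolding L_def using div_mult_mod_eq[of "e i - s i" "p i"] by linarith
  then have dv: "p i dvd e i - s i - L" using pL by (simp add: dvd_diff_nat)
  show "W ! (e i - L + k) = word i k" if "k < L" for k
  proof -
    have "W ! (s i + (e i - s i - L + k)) = word i (e i - s i - L + k)"
      using L2 that by (intro word_nth[OF i]) simp
    also have "\<dots> = word i k" using dv by (auto simp: word_def elim!: dvdE)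
    also have "s i + (e i - s i - L + k) = e i - L + k" using L2 by simp
    finally show ?thesis .
  qed
  show "word i L = word i (e i - s i)"
    using pL by (auto simp: word_def L_def elim!: dvdE)
qed

text \<open>The windows spell prefixes of \<open>F\<close> followed by the breaking letter. The
  shorter of two windows breaks first, while the longer still follows \<open>F\<close>. Upward
  breaks thus need lengths increasing from left to right, downward breaks decreasing ones.\<close>

lemma not_all_breaking_alike:
  assumes idx: "\<And>j. j < n \<Longrightarrow> idx j < m \<and> e (idx j) < length W \<and> word (idx j) = F"
    and incr: "\<And>j j'. j < j' \<Longrightarrow> j' < n \<Longrightarrow> idx j < idx j'"
    and dir: "(\<forall>j<n. F (e (idx j) - s (idx j)) < W ! e (idx j)) \<or> (\<forall>j<n. W ! e (idx j) < F (e (idx j) - s (idx j)))"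
  shows False
proof -
  define up where "up \<longleftrightarrow> (\<forall>j<n. F (e (idx j) - s (idx j)) < W ! e (idx j))"
  define c where "c j = (if up then Suc j else n - j)" for j
  define L where "L j = (e (idx j) - s (idx j)) mod p (idx j) + c j * step" for j
  have c: "1 \<le> c j" "c j \<le> n" if "j < n" for j using that by (auto simp: c_def)
  have L: "L j < Suc (c j) * step" "s (idx j) + L j < e (idx j)" "\<And>k. k < L j \<Longrightarrow> W ! (e (idx j) - L j + k) = F k"
    "F (L j) = F (e (idx j) - s (idx j))" if "j < n" for j
    using end_window[OF _ c[OF that], of "idx j"] idx[OF that] unfolding L_def by auto
  have Lless: "L j < L j'" if "c j < c j'" "j < n" for j j'
  proof -
    have "Suc (c j) * step \<le> c j' * step" using that by (intro mult_le_mono1) simp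
    then show ?thesis using L(1)[OF that(2)] unfolding L_def[of j'] by linarith
  qed
  have "divisible n W"
    unfolding divisible_def
  proof (rule exI[of _ "\<lambda>j. e (idx j) - L j"], rule exI[of _ "\<lambda>j. Suc (L j)"], intro conjI allI impI)
    fix j assume "j < n"
    then show "e (idx j) - L j + Suc (L j) \<le> length W" using L(2)[of j] idx[of j] by simp
  next
    fix j j' assume jj: "j < j' \<and> j' < n"
    then have jn: "j < n" "j' < n" by auto
    have "e (idx j) \<le> s (idx j')" using ordered incr idx jj by simp
    then show "e (idx j) - L j + Suc (L j) \<le> e (idx j') - L j'"
      using L(2)[OF jn(1)] L(2)[OF jn(2)] by linarith
    show "\<exists>k<Suc (L j). k < Suc (L j') \<and> (\<forall>i<k. W ! (e (idx j') - L j' + i) = W ! (e (idx j) - L j + i)) \<and>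
       W ! (e (idx j') - L j' + k) < W ! (e (idx j) - L j + k)"
    proof (cases up)
      case True
      then have less: "L j < L j'" using jj by (intro Lless) (auto simp: c_def)
      have "F (e (idx j) - s (idx j)) < W ! e (idx j)" using True jn by (simp add: up_def)
      then show ?thesis using less L(2,3,4)[OF jn(1)] L(3)[OF jn(2)]
        by (intro exI[of _ "L j"]) auto
    next
      case False
      then have less: "L j' < L j" using jj by (intro Lless) (auto simp: c_def)
      have "W ! e (idx j') < F (e (idx j') - s (idx j'))" using False dir jn by (auto simp: up_def)
      then show ?thesis using less L(2,3,4)[OF jn(2)] L(3)[OF jn(1)]
        by (intro exI[of _ "L j'"]) auto
    qed
  qed
  then show False using nd by contradiction
qed

lemma break:
  assumes "i < m" "e i < length W"
  shows "W ! e i \<noteq> word i (e i - s i)"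
proof -
  note pf = p_facts[OF assms(1)]
  have le: "p i \<le> e i - s i" using pf step_ge step_mult_le[of 1] by linarith
  have "word i (e i - s i) = word i (e i - s i - p i)" using le by (simp add: word_def le_mod_geq)
  also have "\<dots> = W ! (s i + (e i - s i - p i))" using pf le by (intro word_nth[symmetric] assms) linarith
  also have "s i + (e i - s i - p i) = e i - p i" using le pf by simp
  finally show ?thesis using pc[OF assms(1)] assms(2) by (simp add: piece_def)
qed

text \<open>At most \<open>n - 1\<close> pieces share both the word and the direction of the break;
  the factor 2 counts the directions.\<close>

theorem card_pieces:
  assumes "n \<le> 3 ^ c"
  shows "m \<le> 2 * (n - 1) ^ 3 * n ^ (3 * c + 1) * l + 1"
proof -
  define up where "up i \<longleftrightarrow> word i (e i - s i) < W ! e i" for i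
  \<comment> \<open>The last piece may reach the end of \<open>W\<close> and then has no break; it
    accounts for the final \<open>+ 1\<close>.\<close>
  let ?A = "{..<m - 1}"
  let ?key = "\<lambda>i. (word i, up i)"
  have nonfinal: "i < m" "e i < length W" if "i \<in> ?A" for i
  proof -
    show "i < m" using that by simp
    have "e i \<le> s (Suc i)" "s (Suc i) + M \<le> e (Suc i)" "e (Suc i) \<le> length W"
      using ordered[of i "Suc i"] p_facts[of "Suc i"] that by auto
    moreover have "0 < M" using step_ge step_mult_le[of 1] n by (cases n) auto
    ultimately show "e i < length W" by linarith
  qed
  have fiber: "card {i\<in>?A. ?key i = b} \<le> n - 1" if "b \<in> ?key ` ?A" for b
  proof (rule ccontr)
    assume "\<not> ?thesis"
    then have "n \<le> card {i\<in>?A. ?key i = b}" by simp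
    then obtain idx where idx: "\<And>j. j < n \<Longrightarrow> idx j \<in> {i\<in>?A. ?key i = b}"
      "\<And>j j'. j < j' \<Longrightarrow> j' < n \<Longrightarrow> idx j < idx j'"
      using increasing_enumeration[of "{i\<in>?A. ?key i = b}" n] by auto
    have in_A: "idx j \<in> ?A" and key: "word (idx j) = fst b" "up (idx j) = snd b" if "j < n" for j
      using idx(1)[OF that] by auto
    show False
    proof (rule not_all_breaking_alike[of idx "fst b"])
      show "idx j < m \<and> e (idx j) < length W \<and> word (idx j) = fst b" if "j < n" for j
        using nonfinal[OF in_A[OF that]] key[OF that] by simp
      show "(\<forall>j<n. fst b (e (idx j) - s (idx j)) < W ! e (idx j)) \<or>
            (\<forall>j<n. W ! e (idx j) < fst b (e (idx j) - s (idx j)))"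
      proof (cases "snd b")
        case True
        then show ?thesis using key by (auto simp: up_def)
      next
        case False
        have "W ! e (idx j) < fst b (e (idx j) - s (idx j))" if "j < n" for j
          using key[OF that] False break[OF nonfinal[OF in_A[OF that]]] by (auto simp: up_def)
        then show ?thesis by blast
      qed
    qed (fact idx(2))
  qed
  have "m - 1 \<le> (n - 1) * card (?key ` ?A)" using card_le_fibers[of ?A ?key, OF _ fiber] by simp
  also have "card (?key ` ?A) \<le> card ((word ` {..<m}) \<times> (UNIV :: bool set))"
    by (intro card_mono) auto
  also have "\<dots> = 2 * card (word ` {..<m})" by (simp add: card_cartesian_product)
  also have "\<dots> \<le> 2 * ((n - 1)\<^sup>2 * n ^ (3 * c + 1) * l)" using card_words_le[OF assms] by simp
  finally have "m - 1 \<le> (n - 1) * (2 * ((n - 1)\<^sup>2 * n ^ (3 * c + 1) * l))" by simp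
  also have "\<dots> = 2 * (n - 1) ^ 3 * n ^ (3 * c + 1) * l" by (simp add: power2_eq_square power3_eq_cube)
  finally show ?thesis by simp
qed

end

section \<open>The essential height\<close>

lemma length_filter_mono: "(\<And>x. x \<in> set xs \<Longrightarrow> P x \<Longrightarrow> Q x) \<Longrightarrow> length (filter P xs) \<le> length (filter Q xs)"
  by (induction xs) (auto simp: le_SucI)

lemma le_three_power_log: "1 \<le> n \<Longrightarrow> n \<le> 3 ^ nat \<lceil>log 3 (real n)\<rceil>"
proof -
  assume "1 \<le> n"
  then have "real n = 3 powr log 3 (real n)" by simp
  also have "\<dots> \<le> 3 powr real (nat \<lceil>log 3 (real n)\<rceil>)" by (intro powr_mono) linarith+
  also have "\<dots> = real (3 ^ nat \<lceil>log 3 (real n)\<rceil>)" by (simp add: powr_realpow)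
  finally show ?thesis by (simp only: of_nat_le_iff)
qed

text \<open>\<open>D\<close> collects the products of all words up to length \<open>N + n\<close>,
  so only powers longer than that count towards \<open>h\<close>, at most one for each
  piece.\<close>

lemma nondivisible_in_products:
  fixes a :: "nat \<Rightarrow> 'b::ring"
  assumes l: "1 \<le> l" and n: "2 \<le> n" and c: "n \<le> 3 ^ c" and W: "W \<noteq> []" "set W \<subseteq> {..<l}" "\<not> divisible n W"
    and M: "M = (n + 2) * ((n * n + n) * fact n)" and N: "N = (M + n) * (n * l ^ (M + n))"
    and h: "h = 2 * (n - 1) ^ 3 * n ^ (3 * c + 1) * l + 1"
    and D: "D = (\<lambda>w. lprod (map a w)) ` {w. set w \<subseteq> {..<l} \<and> length w \<le> N + n}"
    and Y: "Y = {lprod (map a w) | w. w \<noteq> [] \<and> length w < n \<and> set w \<subseteq> {..<l}}"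
  shows "lprod (map a W) \<in> {lprod ts | ts. ts \<noteq> [] \<and> length ts \<le> 2 * h + 1 \<and>
        (\<forall>t\<in>set ts. t \<in> D \<or> (\<exists>y\<in>Y. \<exists>k\<ge>1. t = lprod (replicate k y))) \<and>
        length (filter (\<lambda>t. t \<notin> D) ts) \<le> h}"
proof -
  have "1 \<le> (n * n + n) * fact n" using n by (simp add: Suc_le_eq)
  then have "(n + 2) * 1 \<le> M" unfolding M by (rule mult_le_mono2)
  then have nM: "n \<le> M" by simp
  obtain ps where ps: "pieces_from W n M N 0 ps"
    using pieces_exist[OF l _ W(2,3) N nM, of 0] n by auto
  interpret lp: long_pieces W l n "length ps" M "\<lambda>i. fst (ps ! i)" "\<lambda>i. fst (snd (ps ! i))" "\<lambda>i. snd (snd (ps ! i))"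
    by unfold_locales (use l n W M pieces_from_piece[OF ps] pieces_from_ordered[OF ps] in \<open>auto\<close>)
  have lenps: "length ps \<le> h" using lp.card_pieces[OF c] by (simp add: h)
  obtain ws where ws: "W = concat ws" "length ws \<le> 2 * length ps + 1" "[] \<notin> set ws"
    "\<forall>w\<in>set ws. length w \<le> N + n \<or>
       (\<exists>y k. y \<noteq> [] \<and> length y < n \<and> set y \<subseteq> set W \<and> 1 \<le> k \<and> w = concat (replicate k y))"
    "length (filter (\<lambda>w. N + n < length w) ws) \<le> length ps"
    using pieces_factorization[OF ps, of 0] nM by auto
  define g where "g w = lprod (map a w)" for w
  have wsne: "ws \<noteq> []" using ws(1) W(1) by auto
  have letters: "set w \<subseteq> {..<l}" if "w \<in> set ws" for w using that W(2) ws(1) by auto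
  have inD: "g w \<in> D" if "w \<in> set ws" "length w \<le> N + n" for w
    using letters[OF that(1)] that(2) by (auto simp: D g_def)
  have "lprod (map a W) = lprod (concat (map (map a) ws))" by (simp add: ws(1) map_concat)
  also have "\<dots> = lprod (map lprod (map (map a) ws))" using wsne ws(3) by (intro lprod_concat) auto
  also have "\<dots> = lprod (map g ws)" by (simp add: g_def[abs_def] o_def)
  finally have eq: "lprod (map a W) = lprod (map g ws)" .
  have mem: "t \<in> D \<or> (\<exists>y\<in>Y. \<exists>k\<ge>1. t = lprod (replicate k y))" if t: "t \<in> set (map g ws)" for t
  proof -
    obtain w where w: "w \<in> set ws" "t = g w" using t by auto
    show ?thesis
    proof (cases "length w \<le> N + n")
      case True
      then show ?thesis using inD w by blast
    next
      case False
      then obtain y k where y: "y \<noteq> []" "length y < n" "set y \<subseteq> set W" "1 \<le> k" "w = concat (replicate k y)"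
        using ws(4) w(1) by blast
      have "t = lprod (concat (replicate k (map a y)))" by (simp add: w(2) g_def y(5) map_concat)
      also have "\<dots> = lprod (map lprod (replicate k (map a y)))" using y by (intro lprod_concat) auto
      finally have "t = lprod (replicate k (g y))" by (simp add: g_def)
      moreover have "g y \<in> Y" using y W(2) by (auto simp: Y g_def)
      ultimately show ?thesis using y(4) by blast
    qed
  qed
  have "length (filter (\<lambda>t. t \<notin> D) (map g ws)) = length (filter (\<lambda>w. g w \<notin> D) ws)"
    by (simp add: filter_map o_def)
  also have "\<dots> \<le> length (filter (\<lambda>w. N + n < length w) ws)"
    using inD by (intro length_filter_mono) (meson not_le)
  finally have "length (filter (\<lambda>t. t \<notin> D) (map g ws)) \<le> h" using ws(5) lenps by simp
  moreover have "length (map g ws) \<le> 2 * h + 1" using ws(2) lenps by simp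
  ultimately show ?thesis using eq mem wsne by (intro CollectI exI[of _ "map g ws"]) auto
qed

text \<open>The first conjunct ensures that the \<open>LEAST\<close> in
  \<open>essential_height\<close> is attained.\<close>

theorem mainTheorem6:
  fixes smul :: "'k::comm_ring_1 \<Rightarrow> 'b::ring \<Rightarrow> 'b"
    and a :: "nat \<Rightarrow> 'b" and l n :: nat and f :: "nat list \<Rightarrow> 'k"
  assumes "l \<ge> 1" and "n \<ge> 1"
    and "is_algebra smul"
    and "generated_by smul a l"
    and "admissible_poly f n"
    and "is_identity smul f"
  shows "(\<exists>h. ess_height_witness smul
            {lprod (map a w) | w. w \<noteq> [] \<and> length w < n \<and> set w \<subseteq> {..<l}} h)
    \<and> essential_height smul
            {lprod (map a w) | w. w \<noteq> [] \<and> length w < n \<and> set w \<subseteq> {..<l}} < Upsilon n l"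
proof -
  interpret module smul using assms(3) by (simp add: is_algebra_def)
  let ?Y = "{lprod (map a w) | w. w \<noteq> [] \<and> length w < n \<and> set w \<subseteq> {..<l}}"
  obtain c where c1: "c [0..<n] = 1"
    and lin: "\<And>y. (\<Sum>js\<in>{js. length js = n \<and> set js = {..<n}}. smul (c js) (lprod (map y js))) = 0"
    using identity_linearization[OF assms(3,5,6)] by blast
  have "\<exists>h < Upsilon n l. ess_height_witness smul ?Y h"
  proof (cases "n = 1")
    case True
    \<comment> \<open>In degree 1 the linearized identity reads \<open>x = 0\<close>, so the algebra
      is zero and height 0 suffices.\<close>
    have perms: "{js. length js = n \<and> set js = {..<n}} = {[0]}"
      unfolding True One_nat_def lessThan_Suc lessThan_0
    proof (intro equalityI subsetI)
      fix js :: "nat list" assume "js \<in> {js. length js = Suc 0 \<and> set js = insert 0 {}}"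
      then show "js \<in> {[0]}" by (cases js) auto
    qed simp
    then have zero: "x = 0" for x :: 'b using lin[of "\<lambda>_. x"] c1 True by simp
    have "x \<in> span S" for x S by (subst zero[of x]) (rule span_zero)
    then have "span S = UNIV" for S by blast
    then have "ess_height_witness smul ?Y 0" unfolding ess_height_witness_def by blast
    then show ?thesis using True assms(1) by (intro exI[of _ 0]) (simp add: Upsilon_def)
  next
    case False
    then have n: "2 \<le> n" using assms(2) by simp
    define ex where "ex = nat \<lceil>log 3 (real n)\<rceil>"
    define h where "h = 2 * (n - 1) ^ 3 * n ^ (3 * ex + 1) * l + 1"
    define M where "M = (n + 2) * ((n * n + n) * fact n)"
    define N where "N = (M + n) * (n * l ^ (M + n))"
    define D where "D = (\<lambda>w. lprod (map a w)) ` {w. set w \<subseteq> {..<l} \<and> length w \<le> N + n}"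
    let ?T = "{lprod ts | ts. ts \<noteq> [] \<and> length ts \<le> 2 * h + 1 \<and>
        (\<forall>t\<in>set ts. t \<in> D \<or> (\<exists>y\<in>?Y. \<exists>k\<ge>1. t = lprod (replicate k y))) \<and>
        length (filter (\<lambda>t. t \<notin> D) ts) \<le> h}"
    let ?G = "{lprod (map a w) | w. w \<noteq> [] \<and> set w \<subseteq> {..<l} \<and> \<not> divisible n w}"
    have nex: "n \<le> 3 ^ ex" using le_three_power_log assms(2) by (simp add: ex_def)
    have "?G \<subseteq> ?T"
      using nondivisible_in_products[OF assms(1) n nex _ _ _ M_def N_def h_def D_def refl] by blast
    then have "span ?G \<subseteq> span ?T" by (rule span_mono)
    moreover have "{lprod (map a w) | w. w \<noteq> [] \<and> set w \<subseteq> {..<l}} \<subseteq> span ?G"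
      using lprod_in_span_nondivisible[where c = c, OF assms(3) n c1 lin] by blast
    then have "span {lprod (map a w) | w. w \<noteq> [] \<and> set w \<subseteq> {..<l}} \<subseteq> span ?G"
      by (rule span_minimal) (rule subspace_span)
    then have "span ?G = UNIV" using assms(4) by (auto simp: generated_by_def)
    ultimately have "span ?T = UNIV" by blast
    moreover have "finite D" unfolding D_def by (intro finite_imageI finite_lists_length_le) simp
    ultimately have "ess_height_witness smul ?Y h" unfolding ess_height_witness_def by blast
    moreover have "h < Upsilon n l"
    proof -
      \<comment> \<open>Passing from \<open>(n - 1) ^ 3\<close> to \<open>n ^ 3\<close> gains at
        least \<open>2 * n ^ (3 * ex + 1) * l\<close>, which outweighs the \<open>+ 1\<close> in
        \<open>h\<close>.\<close>
      have "(n - 1) ^ 3 + 1 \<le> n ^ 3" using n power_strict_mono[of "n - 1" n 3] by simp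
      then have "2 * n ^ (3 * ex + 1) * l * ((n - 1) ^ 3 + 1) \<le> 2 * n ^ (3 * ex + 1) * l * n ^ 3"
        by (rule mult_le_mono2)
      also have "\<dots> = 2 * n ^ (3 * ex + 1 + 3) * l" unfolding power_add[of n _ 3] by (simp only: mult_ac)
      also have "\<dots> = Upsilon n l" by (simp add: Upsilon_def ex_def add.commute)
      finally have "h + 2 * n ^ (3 * ex + 1) * l \<le> Upsilon n l + 1" by (simp add: h_def algebra_simps)
      moreover have "1 \<le> n ^ (3 * ex + 1) * l" using assms(1) n by simp
      ultimately show ?thesis by linarith
    qed
    ultimately show ?thesis by blast
  qed
  then show ?thesis unfolding essential_height_def by (meson Least_le le_less_trans)
qed

end
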